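(* Let $n,m\ge 1$ and let $\mathcal{A}^1,\dots,\mathcal{A}^n:\mathbb{R}^m\to\mathbb{R}^{m\times m}$ be smooth functions with values in the symmetric matrices. Consider the system $$\partial_t u=\mathcal{A}^j(u)\,\partial_j u,\qquad u=u(t,x)\in\mathbb{R}^m,\ x\in\mathbb{R}^n .$$ Uniqueness holds in the Lipschitz class: two Lipschitz solutions on $[0,T]$ with the same initial data coincide on $[0,T]$. Moreover, there is a function $C:[0,\infty)\to(0,\infty)$, depending only on $n$, $m$ and the $\mathcal{A}^j$, such that for any two Lipschitz solutions $u_1,u_2$ on $[0,T]$ with $(u_1-u_2)(0)\in L^2(\mathbb{R}^n)$ and all $t\in[0,T]$, $$\|(u_1-u_2)(t)\|_{L^2}\le C(A)\,e^{C(A)\int_0^t B(\tau)\,d\tau}\,\|(u_1-u_2)(0)\|_{L^2}.$$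
   Context: Repeated indices $j$ are summed over $1,\dots,n$, and $\partial_j=\partial_{x_j}$. A Lipschitz solution on $[0,T]$ is a bounded Lipschitz function $u:[0,T]\times\mathbb{R}^n\to\mathbb{R}^m$ which satisfies the system almost everywhere. The control parameters are $A=A_1+A_2$ and $B(t)=B_1(t)+B_2(t)$, where $A_i=\|u_i\|_{L^\infty([0,T]\times\mathbb{R}^n)}$ and $B_i(t)=\|\nabla u_i(t)\|_{L^\infty(\mathbb{R}^n)}$, with $\nabla$ the spatial gradient. Implicit constants in the estimates are allowed to depend on $A$. *)

theory Defs
  imports "HOL-Analysis.Analysis" "HOL-Probability.Essential_Supremum"
begin

primrec C_k :: "nat \<Rightarrow> ('a::real_normed_vector \<Rightarrow> 'b::real_normed_vector) \<Rightarrow> bool" where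
  "C_k 0 f \<longleftrightarrow> continuous_on UNIV f"
| "C_k (Suc k) f \<longleftrightarrow>
     (\<forall>x. f differentiable (at x)) \<and> (\<forall>v. C_k k (\<lambda>x. frechet_derivative f (at x) v))"

definition smooth :: "('a::real_normed_vector \<Rightarrow> 'b::real_normed_vector) \<Rightarrow> bool" where
  "smooth f \<longleftrightarrow> (\<forall>k. C_k k f)"

definition has_partial :: "'n::finite \<Rightarrow> (real^'n \<Rightarrow> real^'m::finite) \<Rightarrow> real^'n \<Rightarrow> bool" where
  "has_partial j f x \<longleftrightarrow> (\<lambda>h. f (x + h *\<^sub>R axis j 1)) differentiable (at 0)"

definition partial :: "'n::finite \<Rightarrow> (real^'n \<Rightarrow> real^'m::finite) \<Rightarrow> real^'n \<Rightarrow> real^'m" where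
  "partial j f x = vector_derivative (\<lambda>h. f (x + h *\<^sub>R axis j 1)) (at 0)"

(* The matrix norm on real^'n^'m is the Frobenius norm. For Lipschitz f the partial
   derivatives exist almost everywhere, so their arbitrary values elsewhere are harmless
   under the essential supremum below. *)
definition grad :: "(real^'n::finite \<Rightarrow> real^'m::finite) \<Rightarrow> real^'n \<Rightarrow> real^'n^'m" where
  "grad f x = (\<chi> i j. partial j f x $ i)"

(* esssup is top for a function that is not measurable, and enn2real sends top to 0. This is only
   applied to bounded functions that are measurable for Lebesgue measure. *)
definition Linf_norm :: "'a::euclidean_space set \<Rightarrow> ('a \<Rightarrow> 'b::real_normed_vector) \<Rightarrow> real" where
  "Linf_norm S f = enn2real (esssup (lebesgue_on S) (\<lambda>x. ennreal (norm (f x))))"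

definition in_L2 :: "('a::euclidean_space \<Rightarrow> 'b::euclidean_space) \<Rightarrow> bool" where
  "in_L2 f \<longleftrightarrow> f \<in> borel_measurable lebesgue \<and> integrable lebesgue (\<lambda>x. (norm (f x))\<^sup>2)"

(* Meaningful only together with in_L2 f: a divergent Bochner integral is 0. *)
definition L2_norm :: "('a::euclidean_space \<Rightarrow> 'b::euclidean_space) \<Rightarrow> real" where
  "L2_norm f = sqrt (LINT x|lebesgue. (norm (f x))\<^sup>2)"

(* Only the restriction of u to [0,T] matters: hence the one-sided time derivatives at the
   endpoints, which form a null set anyway. *)
definition lipschitz_solution ::
  "('n::finite \<Rightarrow> real^'m::finite \<Rightarrow> real^'m^'m) \<Rightarrow> real \<Rightarrow> (real \<Rightarrow> real^'n \<Rightarrow> real^'m) \<Rightarrow> bool" where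
  "lipschitz_solution \<A> T u \<longleftrightarrow>
     bounded ((\<lambda>(t, x). u t x) ` ({0..T} \<times> UNIV)) \<and>
     (\<exists>L. L-lipschitz_on ({0..T} \<times> UNIV) (\<lambda>(t, x). u t x)) \<and>
     (AE (t, x) in lebesgue_on ({0..T} \<times> UNIV).
        (\<lambda>s. u s x) differentiable (at t within {0..T}) \<and>
        (\<forall>j. has_partial j (u t) x) \<and>
        vector_derivative (\<lambda>s. u s x) (at t within {0..T}) =
          (\<Sum>j\<in>UNIV. \<A> j (u t x) *v partial j (u t) x))"

definition amplitude :: "real \<Rightarrow> (real \<Rightarrow> real^'n::finite \<Rightarrow> real^'m::finite) \<Rightarrow> real" where
  "amplitude T u = Linf_norm ({0..T} \<times> UNIV) (\<lambda>(t, x). u t x)"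

definition grad_bound :: "(real \<Rightarrow> real^'n::finite \<Rightarrow> real^'m::finite) \<Rightarrow> real \<Rightarrow> real" where
  "grad_bound u t = Linf_norm UNIV (grad (u t))"

end

theory Submission
  imports Defs
begin

text \<open>
The proof is the energy method for symmetric hyperbolic systems. The difference \<open>v = u\<^sub>1 - u\<^sub>2\<close> of
two solutions satisfies almost everywhere
  \<open>\<partial>\<^sub>t v = \<A>\<^sup>j(u\<^sub>1) \<partial>\<^sub>j v + (\<A>\<^sup>j(u\<^sub>1) - \<A>\<^sup>j(u\<^sub>2)) \<partial>\<^sub>j u\<^sub>2\<close>,
and symmetry turns the first term into a divergence,
  \<open>2 v \<bullet> \<A>\<^sup>j(u\<^sub>1) \<partial>\<^sub>j v = \<partial>\<^sub>j (v \<bullet> \<A>\<^sup>j(u\<^sub>1) v) - v \<bullet> (\<partial>\<^sub>j \<A>\<^sup>j(u\<^sub>1)) v\<close>.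
So \<open>|v|\<^sup>2\<close> changes by a divergence and an error of size \<open>(|\<nabla>u\<^sub>1| + |\<nabla>u\<^sub>2|) |v|\<^sup>2\<close>, and Gronwall's
inequality gives the estimate. Uniqueness is the case of vanishing initial difference.

Three points need care.

Integrability: a difference of bounded functions need not be square integrable at later times
before the estimate is known. The energy is therefore weighted with the square of
\<open>max 0 (1 - \<epsilon> (sqrt (1 + |x|\<^sup>2) + c t))\<close>. Its support is bounded and shrinks with speed at least
that of the characteristics, so the flux which the weight creates has the favourable sign and no
trace of \<open>\<epsilon>\<close> remains in the estimate (\<open>weighted_energy_difference_quotients\<close>). Fatou's lemma for
\<open>\<epsilon> \<rightarrow> 0\<close> then shows at once that \<open>v(t)\<close> is square integrable and satisfies the bound
(\<open>L2_bound_of_weighted_energy_bounds\<close>).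

Regularity: Lipschitz functions satisfy the equations only almost everywhere. Integration by parts
is replaced by the observation that a spatial difference quotient has integral zero by translation
invariance; dominated convergence carries this to the limit
(\<open>integrated_difference_quotients_tendsto\<close>). For almost every \<open>t\<close>, difference quotients of the
weighted energy thus have a limit which obeys the differential inequality, and for a Lipschitz
function this suffices for Gronwall's inequality (\<open>gronwall_of_difference_quotients\<close>). The almost
everywhere differentiability that enters is part of the notion of solution.

Measurability: the exponent is an honest integral only if \<open>t \<mapsto> \<parallel>\<nabla>u(t)\<parallel>\<close> in the supremum norm is
measurable. For almost every \<open>t\<close> it is the essential supremum of a section of a Borel function of
\<open>(t, x)\<close>, namely of the limit of difference quotients (\<open>grad_bound_properties\<close>).
\<close>

section \<open>Difference quotients\<close>

lemma add_inverse_Suc_tendsto: "(\<lambda>k. t + 1 / real (Suc k)) \<longlonglongrightarrow> t"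
  using tendsto_add[OF tendsto_const[of t] LIMSEQ_inverse_real_of_nat]
  by (simp add: inverse_eq_divide)

text \<open>All derivatives are used through the quotients with step \<open>1/(k+1)\<close>: limits of a sequence of
measurable functions are measurable, and dominated convergence applies to them.\<close>
lemma difference_quotients_tendsto:
  fixes f :: "real \<Rightarrow> 'b::real_normed_vector"
  assumes deriv: "(f has_vector_derivative D) (at t within S)"
    and S: "\<forall>\<^sub>F k in sequentially. t + 1 / real (Suc k) \<in> S"
  shows "(\<lambda>k. real (Suc k) *\<^sub>R (f (t + 1 / real (Suc k)) - f t)) \<longlonglongrightarrow> D"
proof -
  have "((\<lambda>y. (1 / norm (y - t)) *\<^sub>R (f y - (f t + (y - t) *\<^sub>R D))) \<longlongrightarrow> 0) (at t within S)"
    using deriv by (simp add: has_vector_derivative_def has_derivative_within)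
  moreover have "filterlim (\<lambda>k. t + 1 / real (Suc k)) (at t within S) sequentially"
    unfolding filterlim_at using S add_inverse_Suc_tendsto[of t]
    by (auto elim!: eventually_mono)
  ultimately have "(\<lambda>k. (1 / norm (t + 1 / real (Suc k) - t)) *\<^sub>R
      (f (t + 1 / real (Suc k)) - (f t + (t + 1 / real (Suc k) - t) *\<^sub>R D))) \<longlonglongrightarrow> 0"
    by (rule filterlim_compose)
  then have "(\<lambda>k. real (Suc k) *\<^sub>R (f (t + 1 / real (Suc k)) - f t) - D) \<longlonglongrightarrow> 0"
    by (simp add: scaleR_diff_right scaleR_add_right diff_diff_add del: of_nat_Suc)
  then show ?thesis by (rule LIM_zero_cancel)
qed

text \<open>The divergence theorem on the whole space, in discrete form. The quotients of each \<open>q j\<close> integrate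
to zero because Lebesgue measure is translation invariant. Hence the integrals of \<open>f k\<close> agree with
those of \<open>f k\<close> minus the discrete divergence, which is the quantity that converges pointwise. In the
application \<open>f k\<close> is the time difference quotient of an energy density and \<open>q\<close> is its flux.\<close>
lemma integrated_difference_quotients_tendsto:
  fixes f :: "nat \<Rightarrow> 'a::euclidean_space \<Rightarrow> real" and q :: "'n::finite \<Rightarrow> 'a \<Rightarrow> real"
  assumes f: "\<And>k. f k \<in> borel_measurable lborel" "\<And>k x. \<bar>f k x\<bar> \<le> w x"
    and w: "integrable lborel w"
    and q: "\<And>j. integrable lborel (q j)"
      "\<And>j k x. \<bar>real (Suc k) * (q j (x + (1 / real (Suc k)) *\<^sub>R e j) - q j x)\<bar> \<le> w x"
    and lim: "AE x in lborel. \<exists>d. (\<lambda>k. f k x - (\<Sum>j\<in>UNIV. real (Suc k) *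
        (q j (x + (1 / real (Suc k)) *\<^sub>R e j) - q j x))) \<longlonglongrightarrow> d \<and> d \<le> b x"
    and b: "integrable lborel b"
  shows "\<exists>d. (\<lambda>k. LINT x|lborel. f k x) \<longlonglongrightarrow> d \<and> d \<le> (LINT x|lborel. b x)"
proof -
  define Q where "Q k x = f k x - (\<Sum>j\<in>UNIV. real (Suc k) *
      (q j (x + (1 / real (Suc k)) *\<^sub>R e j) - q j x))" for k x
  \<comment> \<open>a Borel function, whatever \<open>lim\<close> returns on the null set without convergence\<close>
  define D where "D x = lim (\<lambda>k. Q k x)" for x
  have qs: "integrable lborel (\<lambda>x. q j (x + v)) \<and>
      (LINT x|lborel. q j (x + v)) = (LINT x|lborel. q j x)" for j v
  proof -
    have "distr lborel borel ((+) v) = (lborel :: 'a measure)"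
      by (rule lborel_distr_plus)
    then show ?thesis
      using q(1)[of j] integrable_distr_eq[of "(+) v" lborel borel "q j"]
        integral_distr[of "(+) v" lborel borel "q j"]
      by (auto simp: add.commute dest: borel_measurable_integrable)
  qed
  have fi: "integrable lborel (f k)" for k
    by (rule Bochner_Integration.integrable_bound[OF w f(1)]) (auto intro!: order_trans[OF f(2)])
  have meas: "Q k \<in> borel_measurable lborel" for k
    unfolding Q_def using f(1) qs q(1) by (intro borel_measurable_diff borel_measurable_sum
        borel_measurable_times borel_measurable_const) (auto dest: borel_measurable_integrable)
  have Dmeas: "D \<in> borel_measurable lborel"
    unfolding D_def using meas by (rule borel_measurable_lim_metric)
  have bound: "norm (Q k x) \<le> (1 + real CARD('n)) * w x" for k x
  proof -
    have "\<bar>Q k x\<bar> \<le> w x + (\<Sum>j\<in>(UNIV::'n set). w x)"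
      unfolding Q_def using f(2)[of k x]
      by (intro order_trans[OF abs_triangle_ineq4] add_mono order_trans[OF sum_abs] sum_mono q(2)) auto
    then show ?thesis by (simp add: algebra_simps)
  qed
  have conv: "AE x in lborel. (\<lambda>k. Q k x) \<longlonglongrightarrow> D x \<and> D x \<le> b x"
    using lim by eventually_elim (auto simp: Q_def D_def limI convergent_LIMSEQ_iff)
  have wi: "integrable lborel (\<lambda>x. (1 + real CARD('n)) * w x)"
    using w by simp
  have ae: "AE x in lborel. (\<lambda>k. Q k x) \<longlonglongrightarrow> D x" using conv by auto
  have to: "(\<lambda>k. LINT x|lborel. Q k x) \<longlonglongrightarrow> (LINT x|lborel. D x)"
    by (rule integral_dominated_convergence[OF Dmeas meas wi ae]) (use bound in auto)
  have Di: "integrable lborel D"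
    by (rule integrable_dominated_convergence[OF Dmeas meas wi ae]) (use bound in auto)
  have "(LINT x|lborel. Q k x) = (LINT x|lborel. f k x)" for k
    unfolding Q_def using fi qs q(1) by (simp add: Bochner_Integration.integral_diff)
  moreover have "(LINT x|lborel. D x) \<le> (LINT x|lborel. b x)"
    using Di b conv by (intro integral_mono_AE) auto
  ultimately show ?thesis using to by auto
qed

section \<open>Gronwall inequality for Lipschitz functions\<close>

text \<open>The fundamental theorem of calculus for a Lipschitz function: its difference quotients are bounded,
so their almost everywhere limit may be integrated by dominated convergence, while the integrals of
the quotients themselves tend to \<open>F t - F s\<close> by continuity of \<open>F\<close>.\<close>
lemma lipschitz_on_increment_le:
  fixes F K :: "real \<Rightarrow> real"
  assumes lip: "L-lipschitz_on {0..T} F"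
    and K: "set_integrable lebesgue {0..T} (\<lambda>\<tau>. K \<tau> * F \<tau>)"
    and lim: "AE \<tau> in lebesgue. \<tau> \<in> {0<..<T} \<longrightarrow> (\<exists>d.
        (\<lambda>k. real (Suc k) * (F (\<tau> + 1 / real (Suc k)) - F \<tau>)) \<longlonglongrightarrow> d \<and> d \<le> K \<tau> * F \<tau>)"
    and st: "0 \<le> s" "s \<le> t" "t < T"
  shows "F t - F s \<le> (LINT \<tau>:{s..t}|lebesgue. K \<tau> * F \<tau>)"
proof -
  \<comment> \<open>extend \<open>F\<close> by constants, so that every difference quotient is defined and bounded by \<open>L\<close>\<close>
  define c where "c y = max 0 (min T y)" for y :: real
  define H where "H y = F (c y)" for y
  have cT: "c y \<in> {0..T}" for y using st by (auto simp: c_def)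
  have Hc: "H y = F y" if "y \<in> {0..T}" for y using that by (auto simp: H_def c_def)
  have Hlip: "\<bar>H y - H z\<bar> \<le> L * \<bar>y - z\<bar>" for y z
  proof -
    have "\<bar>H y - H z\<bar> \<le> L * \<bar>c y - c z\<bar>"
      using lipschitz_on_normD[OF lip cT cT] by (simp add: H_def)
    also have "\<dots> \<le> L * \<bar>y - z\<bar>"
      using lipschitz_on_nonneg[OF lip] by (intro mult_left_mono) (auto simp: c_def)
    finally show ?thesis .
  qed
  have Hcont: "continuous_on X H" for X
    using Hlip lipschitz_on_nonneg[OF lip]
    by (intro lipschitz_on_continuous_on[of L]) (auto simp: lipschitz_on_def dist_real_def)
  obtain G where G: "\<And>x. x \<in> {-1..T+1} \<Longrightarrow> (G has_vector_derivative H x) (at x within {-1..T+1})"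
    using antiderivative_continuous[OF Hcont] by blast
  define Q where "Q k y = real (Suc k) * (H (y + 1 / real (Suc k)) - H y)" for k y
  have Qb: "\<bar>Q k y\<bar> \<le> L" for k y
    using mult_left_mono[OF Hlip[of "y + 1 / real (Suc k)" y], of "real (Suc k)"]
    by (simp add: Q_def abs_mult)
  have Qcont: "continuous_on X (Q k)" for k X
    unfolding Q_def by (intro continuous_intros continuous_on_compose2[OF Hcont]) auto
  have h1: "(1::real) / real (Suc k) \<le> 1" for k by simp
  have inG: "y \<in> {-1..T+1} \<and> y + 1 / real (Suc k) \<in> {-1..T+1}" if "y \<in> {s..t}" for y k
  proof -
    have "0 \<le> 1 / real (Suc k)" by simp
    then show ?thesis using that st h1[of k] unfolding atLeastAtMost_iff by linarith
  qed
  have int_Q: "(LINT y:{s..t}|lebesgue. Q k y) =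
      real (Suc k) * ((G (t + 1 / real (Suc k)) - G t) - (G (s + 1 / real (Suc k)) - G s))" for k
  proof -
    let ?h = "1 / real (Suc k)"
    have 1: "(H has_integral (G t - G s)) {s..t}"
      using st by (intro fundamental_theorem_of_calculus)
        (auto intro!: has_vector_derivative_within_subset[OF G])
    have "((\<lambda>y. H (y + ?h)) has_integral (G (t + ?h) - G (s + ?h))) {s..t}"
    proof (rule fundamental_theorem_of_calculus[OF st(2), where f = "\<lambda>y. G (y + ?h)"])
      fix y assume y: "y \<in> {s..t}"
      have "(G has_vector_derivative H (y + ?h)) (at (y + ?h) within (\<lambda>y. y + ?h) ` {s..t})"
        by (rule has_vector_derivative_within_subset[OF G]) (use inG y in auto)
      then have "((G \<circ> (\<lambda>y. y + ?h)) has_vector_derivative (1 *\<^sub>R H (y + ?h))) (at y within {s..t})"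
        by (intro vector_diff_chain_within derivative_eq_intros) (auto intro!: derivative_eq_intros)
      then show "((\<lambda>y. G (y + ?h)) has_vector_derivative H (y + ?h)) (at y within {s..t})"
        by (simp add: o_def)
    qed
    then have "(Q k has_integral real (Suc k) * ((G (t + ?h) - G (s + ?h)) - (G t - G s))) {s..t}"
      unfolding Q_def by (intro has_integral_mult_right has_integral_diff 1)
    moreover have "set_integrable lebesgue {s..t} (Q k)"
      using absolutely_integrable_continuous_real[OF Qcont] .
    ultimately show ?thesis
      by (simp add: set_lebesgue_integral_eq_integral(2) integral_unique algebra_simps)
  qed
  \<comment> \<open>the integral of a quotient of \<open>F\<close> is a quotient of its antiderivative \<open>G\<close> at the endpoints\<close>
  have quot: "(\<lambda>k. real (Suc k) * (G (y + 1 / real (Suc k)) - G y)) \<longlonglongrightarrow> F y" if "y \<in> {s..t}" for y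
  proof -
    have "(\<lambda>k. real (Suc k) *\<^sub>R (G (y + 1 / real (Suc k)) - G y)) \<longlonglongrightarrow> H y"
      by (rule difference_quotients_tendsto[OF G]) (use inG that in auto)
    then show ?thesis using Hc[of y] that st by simp
  qed
  have L1: "(\<lambda>k. LINT y:{s..t}|lebesgue. Q k y) \<longlonglongrightarrow> F t - F s"
    unfolding int_Q right_diff_distrib[of "real (Suc _)" "_ - _" "_ - _"]
    using st by (intro tendsto_diff quot) auto
  define D where "D y = lim (\<lambda>k. Q k y)" for y
  have Qm: "Q k \<in> borel_measurable lebesgue" for k
    using borel_measurable_continuous_onI[OF Qcont] by (intro measurable_completion) simp
  have Dm: "D \<in> borel_measurable lebesgue"
    unfolding D_def using Qm by (rule borel_measurable_lim_metric)
  \<comment> \<open>the case \<open>s = 0\<close> includes the left endpoint, where nothing is assumed\<close>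
  have "AE y in lebesgue. y \<noteq> 0"
    by (intro AE_completion) (rule AE_lborel_singleton)
  with lim have ae: "AE y in lebesgue. y \<in> {s..t} \<longrightarrow> (\<lambda>k. Q k y) \<longlonglongrightarrow> D y \<and> D y \<le> K y * F y"
  proof eventually_elim
    case (elim y)
    show ?case
    proof
      assume y: "y \<in> {s..t}"
      with elim st obtain d where d: "(\<lambda>k. real (Suc k) * (F (y + 1 / real (Suc k)) - F y)) \<longlonglongrightarrow> d"
        "d \<le> K y * F y" by force
      have "\<forall>\<^sub>F k in sequentially. y + 1 / real (Suc k) < T"
        using y st by (intro order_tendstoD(2)[OF add_inverse_Suc_tendsto]) auto
      then have "\<forall>\<^sub>F k in sequentially. real (Suc k) * (F (y + 1 / real (Suc k)) - F y) = Q k y"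
        by eventually_elim (use y st in \<open>auto simp: Q_def Hc\<close>)
      from Lim_transform_eventually[OF d(1) this] have "(\<lambda>k. Q k y) \<longlonglongrightarrow> d" .
      with d show "(\<lambda>k. Q k y) \<longlonglongrightarrow> D y \<and> D y \<le> K y * F y" by (simp add: D_def limI)
    qed
  qed
  have Li: "integrable lebesgue (\<lambda>y. indicator {s..t} y *\<^sub>R L)"
    using absolutely_integrable_continuous_real[of s t "\<lambda>_. L"] by (simp add: set_integrable_def)
  have m1: "(\<lambda>y. indicator {s..t} y *\<^sub>R D y) \<in> borel_measurable lebesgue"
    using Dm by (intro borel_measurable_scaleR borel_measurable_indicator) auto
  have m2: "(\<lambda>y. indicator {s..t} y *\<^sub>R Q k y) \<in> borel_measurable lebesgue" for k
    using Qm by (intro borel_measurable_scaleR borel_measurable_indicator) auto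
  have ae2: "AE y in lebesgue. (\<lambda>k. indicator {s..t} y *\<^sub>R Q k y) \<longlonglongrightarrow> indicator {s..t} y *\<^sub>R D y"
    using ae by eventually_elim (auto simp: indicator_def)
  have bd: "AE y in lebesgue. norm (indicator {s..t} y *\<^sub>R Q k y) \<le> indicator {s..t} y *\<^sub>R L" for k
    using Qb by (auto simp: indicator_def)
  have L2: "(\<lambda>k. LINT y:{s..t}|lebesgue. Q k y) \<longlonglongrightarrow> (LINT y:{s..t}|lebesgue. D y)"
    unfolding set_lebesgue_integral_def
    by (rule integral_dominated_convergence[OF m1 m2 Li ae2 bd])
  have Di: "set_integrable lebesgue {s..t} D"
    unfolding set_integrable_def by (rule integrable_dominated_convergence[OF m1 m2 Li ae2 bd])
  have Ki: "set_integrable lebesgue {s..t} (\<lambda>\<tau>. K \<tau> * F \<tau>)"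
    by (rule set_integrable_subset[OF K]) (use st in auto)
  have "F t - F s = (LINT y:{s..t}|lebesgue. D y)"
    using L1 L2 by (rule LIMSEQ_unique)
  also have "\<dots> \<le> (LINT y:{s..t}|lebesgue. K y * F y)"
    by (rule set_integral_mono_AE[OF Di Ki]) (use ae in \<open>auto simp: AE_completion_iff\<close>)
  finally show ?thesis .
qed

text \<open>The rate \<open>K\<close> is only integrable, so the usual argument, which differentiates \<open>exp (- \<integral>K) F\<close>, would
need Lebesgue's differentiation theorem. Iterating the increment bound over a fine partition avoids
it: on a step of length \<open>h\<close> with mass \<open>k = \<integral>K\<close>, the Lipschitz property gives
\<open>F b \<le> F a (1 + k) + L h k\<close>, and \<open>1 + k \<le> exp k\<close>.\<close>
lemma gronwall_before_endpoint:
  fixes F K :: "real \<Rightarrow> real"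
  assumes lip: "L-lipschitz_on {0..T} F" and F0: "\<And>t. t \<in> {0..T} \<Longrightarrow> 0 \<le> F t"
    and K: "set_integrable lebesgue {0..T} K" and K0: "\<And>t. t \<in> {0..T} \<Longrightarrow> 0 \<le> K t"
    and lim: "AE \<tau> in lebesgue. \<tau> \<in> {0<..<T} \<longrightarrow> (\<exists>d.
        (\<lambda>k. real (Suc k) * (F (\<tau> + 1 / real (Suc k)) - F \<tau>)) \<longlonglongrightarrow> d \<and> d \<le> K \<tau> * F \<tau>)"
    and t: "0 \<le> t" "t < T"
  shows "F t \<le> F 0 * exp (LINT \<tau>:{0..t}|lebesgue. K \<tau>)"
proof -
  have L0: "0 \<le> L" using lip by (rule lipschitz_on_nonneg)
  have Ksub: "set_integrable lebesgue {a..b} K" if "0 \<le> a" "b \<le> T" for a b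
    by (rule set_integrable_subset[OF K]) (use that in auto)
  have KF: "set_integrable lebesgue {0..T} (\<lambda>\<tau>. K \<tau> * F \<tau>)"
  proof -
    have "set_integrable lebesgue {0..T} (\<lambda>\<tau>. F \<tau> * K \<tau>)"
    proof (rule absolutely_integrable_bounded_measurable_product_real)
      show "F \<in> borel_measurable (lebesgue_on {0..T})"
        using lipschitz_on_continuous_on[OF lip] by (intro continuous_imp_measurable_on_sets_lebesgue) auto
      show "bounded (F ` {0..T})"
        using lipschitz_on_continuous_on[OF lip] by (intro compact_imp_bounded compact_continuous_image) auto
    qed (use K in auto)
    then show ?thesis by (simp add: mult.commute)
  qed
  define P where "P s = (LINT \<tau>:{0..s}|lebesgue. K \<tau>)" for s
  have P0: "0 \<le> P s" if "s \<le> T" for s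
    unfolding P_def set_lebesgue_integral_def
    by (rule Bochner_Integration.integral_nonneg) (use K0 that in \<open>auto simp: indicator_def\<close>)
  \<comment> \<open>\<open>N + 1\<close> steps of length \<open>h\<close>; the error term vanishes as \<open>N\<close> grows\<close>
  have main: "F t \<le> (F 0 + L * (t / real (Suc N)) * P t) * exp (P t)" for N
  proof -
    define h where "h = t / real (Suc N)"
    have h0: "0 \<le> h" using t by (simp add: h_def)
    have hs: "real i * h \<le> t" if "i \<le> Suc N" for i
    proof -
      have "real i * h \<le> real (Suc N) * h"
        using that h0 by (intro mult_right_mono) (simp_all del: of_nat_Suc)
      then show ?thesis by (simp add: h_def)
    qed
    have "i \<le> Suc N \<Longrightarrow> F (real i * h) \<le> (F 0 + L * h * P (real i * h)) * exp (P (real i * h))" for i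
    proof (induction i)
      case 0
      have "P 0 = 0"
      proof -
        have "AE x in lebesgue. indicator {0..0::real} x *\<^sub>R K x = 0"
          using AE_completion[OF AE_lborel_singleton[of "0::real"]] by eventually_elim auto
        then show ?thesis unfolding P_def set_lebesgue_integral_def by (rule integral_eq_zero_AE)
      qed
      then show ?case by simp
    next
      case (Suc i)
      define a where "a = real i * h"
      define b where "b = real (Suc i) * h"
      have ab: "0 \<le> a" "a \<le> b" "b = a + h" "b \<le> t"
        using h0 hs[OF Suc.prems] by (auto simp: a_def b_def algebra_simps)
      define k where "k = (LINT \<tau>:{a..b}|lebesgue. K \<tau>)"
      have k0: "0 \<le> k"
        unfolding k_def set_lebesgue_integral_def
        by (rule Bochner_Integration.integral_nonneg) (use K0 ab t in \<open>auto simp: indicator_def\<close>)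
      have Pb: "P b = P a + k"
      proof -
        have "P b = (LINT \<tau>:{0..a} \<union> {a<..b}|lebesgue. K \<tau>)"
          using ab unfolding P_def by (intro arg_cong[where f="\<lambda>X. set_lebesgue_integral lebesgue X K"]) auto
        also have "\<dots> = P a + (LINT \<tau>:{a<..b}|lebesgue. K \<tau>)"
          unfolding P_def using ab t by (intro set_integral_Un set_integrable_subset[OF K]) auto
        also have "(LINT \<tau>:{a<..b}|lebesgue. K \<tau>) = k"
          unfolding k_def
        proof (rule set_integral_cong_set)
          have "set_integrable lebesgue X K" if "X \<in> sets lebesgue" "X \<subseteq> {a..b}" for X
            by (rule set_integrable_subset[OF K]) (use ab t that in auto)
          from this[of "{a<..b}", OF _ greaterThanAtMost_subseteq_atLeastAtMost_iff[THEN iffD2]] this[of "{a..b}"]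
          show "set_borel_measurable lebesgue {a<..b} K" "set_borel_measurable lebesgue {a..b} K"
            unfolding set_borel_measurable_def set_integrable_def
            by (auto intro!: borel_measurable_integrable simp del: real_scaleR_def)
          show "AE x in lebesgue. (x \<in> {a..b}) = (x \<in> {a<..b})"
            using AE_completion[OF AE_lborel_singleton[of a]] by eventually_elim auto
        qed
        finally show ?thesis .
      qed
      have "F b - F a \<le> (LINT \<tau>:{a..b}|lebesgue. K \<tau> * F \<tau>)"
        by (rule lipschitz_on_increment_le[OF lip KF lim]) (use ab t in auto)
      also have "\<dots> \<le> (LINT \<tau>:{a..b}|lebesgue. K \<tau> * (F a + L * h))"
      proof (rule set_integral_mono)
        show "set_integrable lebesgue {a..b} (\<lambda>\<tau>. K \<tau> * F \<tau>)"
          by (rule set_integrable_subset[OF KF]) (use ab t in auto)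
        show "set_integrable lebesgue {a..b} (\<lambda>\<tau>. K \<tau> * (F a + L * h))"
          using Ksub[of a b] ab t by simp
        fix y assume y: "y \<in> {a..b}"
        have "\<bar>F y - F a\<bar> \<le> L * \<bar>y - a\<bar>"
          using lipschitz_on_normD[OF lip, of y a] y ab t by simp
        also have "\<dots> \<le> L * h" using y ab L0 by (intro mult_left_mono) auto
        finally have "F y \<le> F a + L * h" by linarith
        then show "K y * F y \<le> K y * (F a + L * h)" using K0 y ab t by (intro mult_left_mono) auto
      qed
      also have "\<dots> = k * (F a + L * h)" unfolding k_def by simp
      finally have "F b \<le> F a * (1 + k) + L * h * k" by (simp add: algebra_simps)
      also have "\<dots> \<le> F a * exp k + L * h * k * exp k"
        using mult_left_mono[of "1 + k" "exp k" "F a"] mult_left_mono[of 1 "exp k" "L * h * k"]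
          k0 L0 h0 F0[of a] ab t exp_ge_add_one_self[of k] by simp
      also have "\<dots> \<le> (F 0 + L * h * P a) * exp (P a) * exp k + L * h * k * exp (P a) * exp k"
      proof (intro add_mono mult_right_mono)
        show "F a \<le> (F 0 + L * h * P a) * exp (P a)" using Suc by (simp add: a_def)
        have "1 \<le> exp (P a)" using P0[of a] ab t by simp
        then have "L * h * k * 1 \<le> L * h * k * exp (P a)"
          using L0 h0 k0 by (intro mult_left_mono) auto
        then show "L * h * k \<le> L * h * k * exp (P a)" by simp
      qed auto
      also have "\<dots> = (F 0 + L * h * P b) * exp (P b)"
        unfolding Pb exp_add by (simp add: algebra_simps)
      finally show ?case by (simp add: b_def)
    qed
    from this[of "Suc N"] show ?thesis by (simp add: h_def)
  qed
  have "(\<lambda>N. (F 0 + L * (t * (1 / real (Suc N))) * P t) * exp (P t)) \<longlonglongrightarrow> (F 0 + L * (t * 0) * P t) * exp (P t)"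
    using LIMSEQ_inverse_real_of_nat by (intro tendsto_intros) (auto simp: inverse_eq_divide)
  then have "F t \<le> (F 0 + L * (t * 0) * P t) * exp (P t)"
    by (rule LIMSEQ_le_const) (use main in auto)
  then show ?thesis by (simp add: P_def)
qed

lemma gronwall_of_difference_quotients:
  fixes F K :: "real \<Rightarrow> real"
  assumes T: "0 < T"
    and lip: "L-lipschitz_on {0..T} F" and F0: "\<And>t. t \<in> {0..T} \<Longrightarrow> 0 \<le> F t"
    and K: "set_integrable lebesgue {0..T} K" and K0: "\<And>t. t \<in> {0..T} \<Longrightarrow> 0 \<le> K t"
    and lim: "AE \<tau> in lebesgue. \<tau> \<in> {0<..<T} \<longrightarrow> (\<exists>d.
        (\<lambda>k. real (Suc k) * (F (\<tau> + 1 / real (Suc k)) - F \<tau>)) \<longlonglongrightarrow> d \<and> d \<le> K \<tau> * F \<tau>)"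
    and t: "t \<in> {0..T}"
  shows "F t \<le> F 0 * exp (LINT \<tau>:{0..t}|lebesgue. K \<tau>)"
proof (cases "t < T")
  case True
  then show ?thesis using gronwall_before_endpoint[OF lip F0 K K0 lim] t by auto
next
  case False
  with t have tT: "t = T" by auto
  have bound: "F s \<le> F 0 * exp (LINT \<tau>:{0..T}|lebesgue. K \<tau>)" if s: "s \<in> {0..<T}" for s
  proof -
    have "(LINT \<tau>:{0..s}|lebesgue. K \<tau>) \<le> (LINT \<tau>:{0..T}|lebesgue. K \<tau>)"
      using set_integrable_subset[OF K, of "{0..s}"] K K0 s
      unfolding set_integrable_def set_lebesgue_integral_def
      by (intro integral_mono) (auto simp: indicator_def)
    then have "F 0 * exp (LINT \<tau>:{0..s}|lebesgue. K \<tau>) \<le> F 0 * exp (LINT \<tau>:{0..T}|lebesgue. K \<tau>)"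
      using F0[of 0] T by (intro mult_left_mono) auto
    then show ?thesis using gronwall_before_endpoint[OF lip F0 K K0 lim, of s] s by auto
  qed
  have "(F \<longlongrightarrow> F T) (at_left T)"
    using lipschitz_on_continuous_on[OF lip] T
    by (auto simp: continuous_on_def at_within_Icc_at_left[symmetric])
  moreover have "\<forall>\<^sub>F s in at_left T. F s \<le> F 0 * exp (LINT \<tau>:{0..T}|lebesgue. K \<tau>)"
    using eventually_at_left_real[OF T] by eventually_elim (rule bound, auto)
  ultimately show ?thesis
    unfolding tT by (rule tendsto_upperbound) simp
qed

section \<open>Bounded Lipschitz functions\<close>

text \<open>Products of Lipschitz functions need not be Lipschitz unless the factors are bounded; the two properties
together are stable under all operations that form the energy density and its flux.\<close>
definition bounded_lipschitz_on :: "'a::metric_space set \<Rightarrow> ('a \<Rightarrow> 'b::real_normed_vector) \<Rightarrow> bool" where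
  "bounded_lipschitz_on S f \<longleftrightarrow> bounded (f ` S) \<and> (\<exists>L. L-lipschitz_on S f)"

lemma bounded_lipschitz_onE:
  assumes "bounded_lipschitz_on S f"
  obtains M where "M > 0" "\<And>x. x \<in> S \<Longrightarrow> norm (f x) \<le> M"
    "\<And>x y. x \<in> S \<Longrightarrow> y \<in> S \<Longrightarrow> norm (f x - f y) \<le> M * dist x y"
proof -
  obtain a where a: "a > 0" "\<And>x. x \<in> S \<Longrightarrow> norm (f x) \<le> a"
    using assms unfolding bounded_lipschitz_on_def bounded_pos by auto
  obtain L where L: "L-lipschitz_on S f"
    using assms unfolding bounded_lipschitz_on_def by auto
  have "norm (f x - f y) \<le> (a + L) * dist x y" if "x \<in> S" "y \<in> S" for x y
    using lipschitz_onD[OF L that] a(1) by (simp add: dist_norm[symmetric] algebra_simps add_increasing2)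
  moreover have "norm (f x) \<le> a + L" if "x \<in> S" for x
    using a(2)[OF that] lipschitz_on_nonneg[OF L] by simp
  moreover have "a + L > 0" using a lipschitz_on_nonneg[OF L] by simp
  ultimately show ?thesis using that by blast
qed

lemma bounded_lipschitz_onI:
  assumes "\<And>x. x \<in> S \<Longrightarrow> norm (f x) \<le> M"
    "\<And>x y. x \<in> S \<Longrightarrow> y \<in> S \<Longrightarrow> norm (f x - f y) \<le> L * dist x y"
  shows "bounded_lipschitz_on S f"
proof -
  have "\<bar>L\<bar>-lipschitz_on S f"
    using assms(2) by (intro lipschitz_onI)
      (auto simp: dist_norm intro!: order_trans[OF assms(2)] mult_right_mono)
  then show ?thesis
    unfolding bounded_lipschitz_on_def bounded_iff using assms(1) by auto
qed

lemma bounded_lipschitz_on_bilinear: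
  assumes b: "bounded_bilinear pr"
    and f: "bounded_lipschitz_on S f" and g: "bounded_lipschitz_on S g"
  shows "bounded_lipschitz_on S (\<lambda>x. pr (f x) (g x))"
proof -
  obtain K where K: "K > 0" "\<And>a b. norm (pr a b) \<le> norm a * norm b * K"
    using bounded_bilinear.pos_bounded[OF b] by blast
  obtain M where M: "M > 0" "\<And>x. x \<in> S \<Longrightarrow> norm (f x) \<le> M"
    "\<And>x y. x \<in> S \<Longrightarrow> y \<in> S \<Longrightarrow> norm (f x - f y) \<le> M * dist x y"
    using bounded_lipschitz_onE[OF f] by blast
  obtain N where N: "N > 0" "\<And>x. x \<in> S \<Longrightarrow> norm (g x) \<le> N"
    "\<And>x y. x \<in> S \<Longrightarrow> y \<in> S \<Longrightarrow> norm (g x - g y) \<le> N * dist x y"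
    using bounded_lipschitz_onE[OF g] by blast
  show ?thesis
  proof (rule bounded_lipschitz_onI)
    fix x assume "x \<in> S"
    then show "norm (pr (f x) (g x)) \<le> M * N * K"
      using K(1) M N by (intro order_trans[OF K(2)] mult_mono) auto
  next
    fix x y assume xy: "x \<in> S" "y \<in> S"
    have "pr (f x) (g x) - pr (f y) (g y) = pr (f x - f y) (g x) + pr (f y) (g x - g y)"
      by (simp add: bounded_bilinear.diff_left[OF b] bounded_bilinear.diff_right[OF b])
    also have "norm \<dots> \<le> (M * dist x y) * N * K + M * (N * dist x y) * K"
      using K(1) M N xy by (intro order_trans[OF norm_triangle_ineq] add_mono
          order_trans[OF K(2)] mult_mono) auto
    finally show "norm (pr (f x) (g x) - pr (f y) (g y)) \<le> (2 * M * N * K) * dist x y"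
      by (simp add: algebra_simps)
  qed
qed

lemma bounded_lipschitz_on_diff:
  assumes f: "bounded_lipschitz_on S f" and g: "bounded_lipschitz_on S g"
  shows "bounded_lipschitz_on S (\<lambda>x. f x - g x)"
proof -
  have "bounded ((\<lambda>x. f x - g x) ` S)"
    using f g bounded_minus_comp unfolding bounded_lipschitz_on_def by blast
  then show ?thesis
    using f g lipschitz_on_diff unfolding bounded_lipschitz_on_def by blast
qed

lemma bounded_lipschitz_on_compose:
  assumes f: "bounded_lipschitz_on S f" and h: "bounded_lipschitz_on R h" and R: "f ` S \<subseteq> R"
  shows "bounded_lipschitz_on S (\<lambda>x. h (f x))"
proof -
  have "bounded ((\<lambda>x. h (f x)) ` S)"
    using h R unfolding bounded_lipschitz_on_def by (metis bounded_subset image_image image_mono)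
  moreover obtain C D where "C-lipschitz_on S f" "D-lipschitz_on R h"
    using f h unfolding bounded_lipschitz_on_def by blast
  then have "(D * C)-lipschitz_on S (\<lambda>x. h (f x))"
    by (intro lipschitz_on_compose2 lipschitz_on_subset[OF _ R])
  ultimately show ?thesis unfolding bounded_lipschitz_on_def by blast
qed

lemma bounded_lipschitz_on_imp_continuous_on:
  "bounded_lipschitz_on S f \<Longrightarrow> continuous_on S f"
  unfolding bounded_lipschitz_on_def using lipschitz_on_continuous_on by blast

lemma bounded_lipschitz_on_section:
  assumes "bounded_lipschitz_on (I \<times> UNIV) (\<lambda>(t, x). g t x)" "t \<in> I"
  shows "bounded_lipschitz_on UNIV (g t)"
proof -
  obtain M where M: "\<And>z. z \<in> I \<times> UNIV \<Longrightarrow> norm (case z of (t, x) \<Rightarrow> g t x) \<le> M"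
    "\<And>z z'. z \<in> I \<times> UNIV \<Longrightarrow> z' \<in> I \<times> UNIV \<Longrightarrow>
      norm ((case z of (t, x) \<Rightarrow> g t x) - (case z' of (t, x) \<Rightarrow> g t x)) \<le> M * dist z z'"
    using bounded_lipschitz_onE[OF assms(1)] by metis
  show ?thesis
  proof (rule bounded_lipschitz_onI)
    show "norm (g t x) \<le> M" for x using M(1)[of "(t, x)"] assms(2) by simp
    show "norm (g t x - g t y) \<le> M * dist x y" for x y
      using M(2)[of "(t, x)" "(t, y)"] assms(2) by (simp add: dist_Pair_Pair)
  qed
qed

lemma integrable_ball_supported:
  fixes h :: "'a::euclidean_space \<Rightarrow> real"
  assumes h: "bounded_lipschitz_on UNIV h" and R: "\<And>x. R \<le> norm x \<Longrightarrow> h x = 0"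
  shows "integrable lborel h"
proof -
  obtain C where C: "\<And>x. \<bar>h x\<bar> \<le> C" using bounded_lipschitz_onE[OF h] by (metis UNIV_I real_norm_def)
  have i: "integrable lborel (\<lambda>x. C * indicator (cball 0 R) x :: real)"
    by (intro integrable_mult_right integrable_real_indicator emeasure_bounded_finite) auto
  show ?thesis
  proof (rule Bochner_Integration.integrable_bound[OF i])
    show "h \<in> borel_measurable lborel"
      using bounded_lipschitz_on_imp_continuous_on[OF h] by (simp add: borel_measurable_continuous_onI)
    show "AE x in lborel. norm (h x) \<le> norm (C * indicator (cball 0 R) x)"
      using C R by (intro AE_I2) (auto simp: indicator_def intro: order_trans[OF _ abs_ge_self])
  qed
qed

lemma integral_of_ball_supported_family_lipschitz:
  fixes g :: "real \<Rightarrow> 'a::euclidean_space \<Rightarrow> real"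
  assumes g: "bounded_lipschitz_on (I \<times> UNIV) (\<lambda>(t, x). g t x)"
    and R: "\<And>t x. t \<in> I \<Longrightarrow> R \<le> norm x \<Longrightarrow> g t x = 0"
  shows "\<exists>L. L-lipschitz_on I (\<lambda>t. LINT x|lborel. g t x)"
proof -
  obtain C where C: "C > 0" "\<And>z z'. z \<in> I \<times> UNIV \<Longrightarrow> z' \<in> I \<times> UNIV \<Longrightarrow>
      norm ((case z of (t, x) \<Rightarrow> g t x) - (case z' of (t, x) \<Rightarrow> g t x)) \<le> C * dist z z'"
    using bounded_lipschitz_onE[OF g] by metis
  define V where "V = measure lborel (cball (0::'a) R)"
  have int: "integrable lborel (g t)" if "t \<in> I" for t
    using bounded_lipschitz_on_section[OF g that] R[OF that] by (rule integrable_ball_supported)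
  have "\<bar>(LINT x|lborel. g t x) - (LINT x|lborel. g s x)\<bar> \<le> C * V * dist t s" if ts: "t \<in> I" "s \<in> I" for t s
  proof -
    have i: "integrable lborel (\<lambda>x. indicator (cball 0 R) x * (C * dist t s) :: real)"
      by (intro integrable_mult_left integrable_real_indicator emeasure_bounded_finite) auto
    have "\<bar>(LINT x|lborel. g t x) - (LINT x|lborel. g s x)\<bar> = \<bar>LINT x|lborel. g t x - g s x\<bar>"
      using int ts by simp
    also have "\<dots> \<le> (LINT x|lborel. \<bar>g t x - g s x\<bar>)"
      by (rule integral_abs_bound)
    also have "\<dots> \<le> (LINT x|lborel. indicator (cball 0 R) (x::'a) * (C * dist t s))"
    proof (rule integral_mono[OF _ i])
      show "integrable lborel (\<lambda>x. \<bar>g t x - g s x\<bar>)" using int ts by simp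
      show "\<bar>g t x - g s x\<bar> \<le> indicator (cball 0 R) x * (C * dist t s)" for x
        using C(2)[of "(t, x)" "(s, x)"] R[of t x] R[of s x] ts
        by (auto simp: indicator_def dist_Pair_Pair)
    qed
    also have "\<dots> = C * V * dist t s" by (simp add: V_def)
    finally show ?thesis .
  qed
  then have "(C * V)-lipschitz_on I (\<lambda>t. LINT x|lborel. g t x)"
    using C(1) by (intro lipschitz_onI) (auto simp: dist_real_def V_def)
  then show ?thesis by blast
qed

section \<open>Coefficient matrices and the energy identity\<close>

lemma smooth_has_derivative:
  assumes "smooth f"
  shows "(f has_derivative frechet_derivative f (at x)) (at x)"
proof -
  have "C_k (Suc 0) f" using assms unfolding smooth_def by blast
  then show ?thesis by (simp add: frechet_derivative_works[symmetric])
qed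

text \<open>Smoothness is formulated through directional derivatives, each continuous on its own. In finite
dimension this is enough, as a linear map is controlled by its values on a basis.\<close>
lemma smooth_bounds_on_cball:
  fixes f :: "'a::euclidean_space \<Rightarrow> 'b::real_normed_vector"
  assumes "smooth f"
  obtains M where "\<And>v. v \<in> cball 0 a \<Longrightarrow> norm (f v) \<le> M"
    "\<And>v w. v \<in> cball 0 a \<Longrightarrow> w \<in> cball 0 a \<Longrightarrow> norm (f v - f w) \<le> M * norm (v - w)"
    "\<And>v y. v \<in> cball 0 a \<Longrightarrow> norm (frechet_derivative f (at v) y) \<le> M * norm y"
proof -
  let ?D = "\<lambda>v. frechet_derivative f (at v)"
  have C1: "C_k (Suc 0) f" using assms unfolding smooth_def by blast
  note D = smooth_has_derivative[OF assms]
  have cont: "continuous_on UNIV f"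
    using D by (auto intro!: continuous_at_imp_continuous_on has_derivative_continuous)
  obtain M0 where M0: "\<And>v. v \<in> cball 0 a \<Longrightarrow> norm (f v) \<le> M0"
    using compact_imp_bounded[OF compact_continuous_image[OF continuous_on_subset[OF cont] compact_cball[of 0 a]]]
    unfolding bounded_iff by blast
  have "\<exists>m. \<forall>v\<in>cball 0 a. norm (?D v b) \<le> m" for b
    using compact_imp_bounded[OF compact_continuous_image[OF continuous_on_subset[of UNIV "\<lambda>v. ?D v b"] compact_cball[of 0 a]]] C1
    by (auto simp: bounded_iff)
  then obtain m where m: "\<And>b v. v \<in> cball 0 a \<Longrightarrow> norm (?D v b) \<le> m b" by metis
  define M1 where "M1 = (\<Sum>b\<in>(Basis::'a set). \<bar>m b\<bar>)"
  have D1: "norm (?D v y) \<le> M1 * norm y" if "v \<in> cball 0 a" for v y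
  proof -
    have lin: "linear (?D v)" using D has_derivative_linear by blast
    have "?D v y = ?D v (\<Sum>b\<in>Basis. (y \<bullet> b) *\<^sub>R b)" by (simp add: euclidean_representation)
    also have "\<dots> = (\<Sum>b\<in>Basis. (y \<bullet> b) *\<^sub>R ?D v b)"
      by (simp add: linear_sum[OF lin] linear_scale[OF lin])
    also have "norm \<dots> \<le> (\<Sum>b\<in>Basis. norm y * \<bar>m b\<bar>)"
      using m[OF that] by (intro order_trans[OF norm_sum] sum_mono)
        (auto intro!: mult_mono Basis_le_norm order_trans[OF _ abs_ge_self])
    finally show ?thesis by (simp add: M1_def sum_distrib_left mult.commute)
  qed
  have M1: "M1 \<ge> 0" unfolding M1_def by (simp add: sum_nonneg)
  have lip: "M1-lipschitz_on (cball 0 a) f"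
    by (rule bounded_derivative_imp_lipschitz[OF has_derivative_at_withinI[OF D]])
      (use D1 M1 in \<open>auto intro!: onorm_le\<close>)
  show ?thesis
  proof (rule that[of "\<bar>M0\<bar> + M1"])
    fix v w :: 'a assume vw: "v \<in> cball 0 a" "w \<in> cball 0 a"
    show "norm (f v - f w) \<le> (\<bar>M0\<bar> + M1) * norm (v - w)"
      using lipschitz_on_normD[OF lip vw] by (simp add: distrib_right add_increasing)
  next
    fix v y :: 'a assume v: "v \<in> cball 0 a"
    show "norm (?D v y) \<le> (\<bar>M0\<bar> + M1) * norm y"
      using D1[OF v, of y] by (simp add: distrib_right add_increasing)
  qed (use M0 M1 in force)
qed

lemma bounded_bilinear_matrix_vector_mult:
  "bounded_bilinear ((*v) :: real^'m^'n \<Rightarrow> real^'m \<Rightarrow> real^'n)"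
  unfolding bilinear_conv_bounded_bilinear[symmetric] bilinear_def
  by (auto simp: linear_iff matrix_vector_mult_add_rdistrib matrix_vector_right_distrib
      matrix_vector_mult_scaleR scaleR_matrix_vector_assoc[symmetric])

text \<open>The quantitative information on the coefficients that enters the estimate; \<open>a\<close> will be the joint amplitude
of the two solutions, and \<open>M\<close> depends on the solutions through \<open>a\<close> alone.\<close>
definition coefficient_bound ::
    "('n::finite \<Rightarrow> real^'m::finite \<Rightarrow> real^'m^'m) \<Rightarrow> real \<Rightarrow> real \<Rightarrow> bool" where
  "coefficient_bound \<A> a M \<longleftrightarrow> M > 0 \<and>
     (\<forall>j v z. norm v \<le> a \<longrightarrow> norm (\<A> j v *v z) \<le> M * norm z) \<and>
     (\<forall>j v w z. norm v \<le> a \<longrightarrow> norm w \<le> a \<longrightarrow> norm ((\<A> j v - \<A> j w) *v z) \<le> M * norm (v - w) * norm z) \<and>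
     (\<forall>j v y z. norm v \<le> a \<longrightarrow> norm (frechet_derivative (\<A> j) (at v) y *v z) \<le> M * norm y * norm z) \<and>
     (\<forall>j. bounded_lipschitz_on (cball 0 a) (\<A> j))"

lemma coefficient_bound_exists:
  fixes \<A> :: "'n::finite \<Rightarrow> real^'m::finite \<Rightarrow> real^'m^'m"
  assumes smooth: "\<And>j. smooth (\<A> j)"
  shows "\<exists>M. coefficient_bound \<A> a M"
proof -
  obtain K where K: "K > 0" "\<And>(B::real^'m^'m) z. norm (B *v z) \<le> norm B * norm z * K"
    using bounded_bilinear.pos_bounded[OF bounded_bilinear_matrix_vector_mult] by blast
  have "\<exists>m. (\<forall>v \<in> cball 0 a. norm (\<A> j v) \<le> m) \<and>
      (\<forall>v \<in> cball 0 a. \<forall>w \<in> cball 0 a. norm (\<A> j v - \<A> j w) \<le> m * norm (v - w)) \<and>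
      (\<forall>v \<in> cball 0 a. \<forall>y. norm (frechet_derivative (\<A> j) (at v) y) \<le> m * norm y)" for j
    by (rule smooth_bounds_on_cball[OF smooth[of j], of a]) blast
  then obtain m where m: "\<And>j v. v \<in> cball 0 a \<Longrightarrow> norm (\<A> j v) \<le> m j"
      "\<And>j v w. v \<in> cball 0 a \<Longrightarrow> w \<in> cball 0 a \<Longrightarrow> norm (\<A> j v - \<A> j w) \<le> m j * norm (v - w)"
      "\<And>j v y. v \<in> cball 0 a \<Longrightarrow> norm (frechet_derivative (\<A> j) (at v) y) \<le> m j * norm y"
    by metis
  define M where "M = 1 + (\<Sum>j\<in>UNIV. \<bar>m j\<bar>)"
  have mM: "m j \<le> M" for j
    using member_le_sum[of j UNIV "\<lambda>j. \<bar>m j\<bar>"] by (simp add: M_def)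
  have M0: "M > 0" unfolding M_def by (intro add_pos_nonneg sum_nonneg) auto
  have prod: "norm (B *v z) \<le> M * K * c * norm z" if "norm B \<le> m j * c" "0 \<le> c" for B :: "real^'m^'m" and j c z
  proof -
    have "norm B \<le> M * c" using that mM[of j] by (meson mult_right_mono order_trans)
    then have "norm B * norm z * K \<le> (M * c) * norm z * K"
      using K(1) by (intro mult_right_mono) auto
    then show ?thesis using K(2)[of B z] by (simp add: mult_ac)
  qed
  show ?thesis
    unfolding coefficient_bound_def
  proof (intro exI[of _ "M * K"] conjI allI impI)
    show "M * K > 0" using M0 K by simp
    fix j :: 'n
    show "bounded_lipschitz_on (cball 0 a) (\<A> j)"
      using m by (intro bounded_lipschitz_onI[of _ _ "m j" "m j"]) (auto simp: dist_norm)
    fix v w y z :: "real^'m" assume v: "norm v \<le> a"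
    show "norm (\<A> j v *v z) \<le> M * K * norm z" using prod[of "\<A> j v" j 1 z] m(1) v by simp
    show "norm (frechet_derivative (\<A> j) (at v) y *v z) \<le> M * K * norm y * norm z"
      using prod[OF m(3)[of v j y], of z] v by simp
    assume w: "norm w \<le> a"
    show "norm ((\<A> j v - \<A> j w) *v z) \<le> M * K * norm (v - w) * norm z"
      using prod[OF m(2)[of v w j], of z] v w by simp
  qed
qed

lemma inner_symmetric_matrix:
  fixes B :: "real^'m^'m"
  assumes "transpose B = B"
  shows "w \<bullet> (B *v v) = v \<bullet> (B *v w)"
  by (metis assms dot_lmul_matrix inner_commute transpose_matrix_vector)

text \<open>The pointwise form of the energy estimate. Here \<open>p\<^sub>1\<close>, \<open>p\<^sub>2\<close> stand for the spatial gradients, \<open>r\<^sup>2\<close> for the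
weight, \<open>d j\<close> for its spatial derivatives and \<open>- 2 \<epsilon> n M r\<close> for its time derivative; the left-hand
side is the time derivative of the weighted density minus the divergence of the flux. By symmetry
the terms with \<open>p\<^sub>1 j - p\<^sub>2 j\<close> cancel. The terms without a factor \<open>r\<^sup>2\<close> come from the derivatives of the
weight, and the negative time derivative outweighs the spatial ones.\<close>
lemma energy_density_derivative_le:
  fixes \<A> :: "'n::finite \<Rightarrow> real^'m::finite \<Rightarrow> real^'m^'m" and p\<^sub>1 p\<^sub>2 :: "'n \<Rightarrow> real^'m"
    and a M r \<epsilon> b\<^sub>1 b\<^sub>2 :: real
  assumes bound: "coefficient_bound \<A> a M"
    and symmetric: "\<And>j v. transpose (\<A> j v) = \<A> j v"
    and u: "norm u\<^sub>1 \<le> a" "norm u\<^sub>2 \<le> a"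
    and p: "\<And>j. norm (p\<^sub>1 j) \<le> b\<^sub>1" "\<And>j. norm (p\<^sub>2 j) \<le> b\<^sub>2"
    and r: "0 \<le> r" "0 \<le> \<epsilon>" and d: "\<And>j. \<bar>d j\<bar> \<le> 2 * \<epsilon> * r"
  defines "v \<equiv> u\<^sub>1 - u\<^sub>2"
  shows "- (2 * \<epsilon> * (CARD('n) * M) * r) * (v \<bullet> v)
      + r\<^sup>2 * (2 * (v \<bullet> ((\<Sum>j\<in>UNIV. \<A> j u\<^sub>1 *v p\<^sub>1 j) - (\<Sum>j\<in>UNIV. \<A> j u\<^sub>2 *v p\<^sub>2 j))))
      - (\<Sum>j\<in>UNIV. d j * (v \<bullet> (\<A> j u\<^sub>1 *v v)) + r\<^sup>2 * ((p\<^sub>1 j - p\<^sub>2 j) \<bullet> (\<A> j u\<^sub>1 *v v)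
          + v \<bullet> (frechet_derivative (\<A> j) (at u\<^sub>1) (p\<^sub>1 j) *v v + \<A> j u\<^sub>1 *v (p\<^sub>1 j - p\<^sub>2 j))))
      \<le> 2 * CARD('n) * M * (b\<^sub>1 + b\<^sub>2) * (r\<^sup>2 * (v \<bullet> v))"
    (is "?L \<le> ?R")
proof -
  let ?D = "\<lambda>j. frechet_derivative (\<A> j) (at u\<^sub>1) (p\<^sub>1 j)"
  let ?n = "real CARD('n)"
  have M: "M > 0" using bound by (simp add: coefficient_bound_def)
  have b0: "0 \<le> b\<^sub>1" "0 \<le> b\<^sub>2" using p norm_ge_zero order_trans by blast+
  define X where "X j = r\<^sup>2 * (2 * (v \<bullet> ((\<A> j u\<^sub>1 - \<A> j u\<^sub>2) *v p\<^sub>2 j)))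
      - d j * (v \<bullet> (\<A> j u\<^sub>1 *v v)) - r\<^sup>2 * (v \<bullet> (?D j *v v))" for j
  let ?q = "\<lambda>j. \<A> j u\<^sub>1 *v (p\<^sub>1 j - p\<^sub>2 j)"
  let ?w = "\<lambda>j. ?q j + (\<A> j u\<^sub>1 - \<A> j u\<^sub>2) *v p\<^sub>2 j"
  have "\<A> j u\<^sub>1 *v p\<^sub>1 j - \<A> j u\<^sub>2 *v p\<^sub>2 j = ?w j" for j
    by (simp add: matrix_vector_mult_diff_distrib matrix_vector_mult_diff_rdistrib)
  then have w: "(\<Sum>j\<in>UNIV. \<A> j u\<^sub>1 *v p\<^sub>1 j) - (\<Sum>j\<in>UNIV. \<A> j u\<^sub>2 *v p\<^sub>2 j) = (\<Sum>j\<in>UNIV. ?w j)"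
    by (simp add: sum_subtractf[symmetric])
  have "(p\<^sub>1 j - p\<^sub>2 j) \<bullet> (\<A> j u\<^sub>1 *v v) = v \<bullet> ?q j" for j
    by (rule inner_symmetric_matrix[OF symmetric])
  then have "X j = r\<^sup>2 * (2 * (v \<bullet> ?w j)) - (d j * (v \<bullet> (\<A> j u\<^sub>1 *v v))
      + r\<^sup>2 * ((p\<^sub>1 j - p\<^sub>2 j) \<bullet> (\<A> j u\<^sub>1 *v v) + v \<bullet> (?D j *v v + ?q j)))" for j
    unfolding X_def by (simp add: inner_add_right distrib_left)
  then have eq: "?L = - (2 * \<epsilon> * (?n * M) * r) * (v \<bullet> v) + (\<Sum>j\<in>UNIV. X j)"
    unfolding w by (simp add: inner_sum_right sum_distrib_left sum_subtractf)
  \<comment> \<open>the three terms are the coefficient difference, the derivative of the weight and the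
    derivative of the coefficient\<close>
  have X: "X j \<le> 2 * M * (b\<^sub>1 + b\<^sub>2) * (r\<^sup>2 * (v \<bullet> v)) + 2 * \<epsilon> * M * r * (v \<bullet> v)" for j
  proof -
    have vv: "v \<bullet> v = norm v * norm v" by (simp add: power2_norm_eq_inner[symmetric] power2_eq_square)
    have cs: "\<bar>v \<bullet> w\<bar> \<le> norm v * k" if "norm w \<le> k" for w k
      using that by (intro order_trans[OF Cauchy_Schwarz_ineq2] mult_left_mono) auto
    have "norm ((\<A> j u\<^sub>1 - \<A> j u\<^sub>2) *v p\<^sub>2 j) \<le> M * norm v * norm (p\<^sub>2 j)"
      using bound u by (auto simp: coefficient_bound_def v_def)
    also have "\<dots> \<le> M * norm v * b\<^sub>2" using M p by (intro mult_left_mono) auto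
    finally have 1: "v \<bullet> ((\<A> j u\<^sub>1 - \<A> j u\<^sub>2) *v p\<^sub>2 j) \<le> M * b\<^sub>2 * (v \<bullet> v)"
      using cs[of "(\<A> j u\<^sub>1 - \<A> j u\<^sub>2) *v p\<^sub>2 j" "M * norm v * b\<^sub>2"] vv by (simp add: mult_ac)
    have 2: "\<bar>v \<bullet> (\<A> j u\<^sub>1 *v v)\<bar> \<le> M * (v \<bullet> v)"
      using cs[of "\<A> j u\<^sub>1 *v v" "M * norm v"] bound u vv by (auto simp: coefficient_bound_def mult_ac)
    have "norm (?D j *v v) \<le> M * norm (p\<^sub>1 j) * norm v"
      using bound u by (auto simp: coefficient_bound_def)
    also have "\<dots> \<le> M * b\<^sub>1 * norm v" using M p by (intro mult_right_mono mult_left_mono) auto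
    finally have 3: "- (v \<bullet> (?D j *v v)) \<le> M * b\<^sub>1 * (v \<bullet> v)"
      using cs[of "?D j *v v" "M * b\<^sub>1 * norm v"] vv by (simp add: mult_ac)
    have "\<bar>d j * (v \<bullet> (\<A> j u\<^sub>1 *v v))\<bar> \<le> (2 * \<epsilon> * r) * (M * (v \<bullet> v))"
      unfolding abs_mult using d 2 r by (intro mult_mono) auto
    then have 4: "- (d j * (v \<bullet> (\<A> j u\<^sub>1 *v v))) \<le> 2 * \<epsilon> * M * r * (v \<bullet> v)"
      by (simp add: mult_ac)
    have "X j \<le> r\<^sup>2 * (2 * (M * b\<^sub>2 * (v \<bullet> v))) + 2 * \<epsilon> * M * r * (v \<bullet> v) + r\<^sup>2 * (M * b\<^sub>1 * (v \<bullet> v))"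
      using mult_left_mono[OF 1, of "r\<^sup>2"] mult_left_mono[OF 3, of "r\<^sup>2"] 4
      unfolding X_def by simp
    moreover have "0 \<le> r\<^sup>2 * (M * b\<^sub>1 * (v \<bullet> v))" using M b0 by simp
    ultimately show ?thesis by (simp add: algebra_simps)
  qed
  have "(\<Sum>j\<in>UNIV. X j) \<le> (\<Sum>j\<in>(UNIV::'n set). 2 * M * (b\<^sub>1 + b\<^sub>2) * (r\<^sup>2 * (v \<bullet> v)) + 2 * \<epsilon> * M * r * (v \<bullet> v))"
    by (intro sum_mono X)
  then show ?thesis unfolding eq by (simp add: algebra_simps)
qed

lemma flux_has_derivative:
  fixes B :: "real^'m::finite \<Rightarrow> real^'m^'m"
  assumes "(\<phi> has_vector_derivative d) (at t within S)"
    "(u\<^sub>1 has_vector_derivative p\<^sub>1) (at t within S)" "(u\<^sub>2 has_vector_derivative p\<^sub>2) (at t within S)"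
    "(B has_derivative B') (at (u\<^sub>1 t))"
  defines "v \<equiv> u\<^sub>1 t - u\<^sub>2 t"
  shows "((\<lambda>h. \<phi> h * ((u\<^sub>1 h - u\<^sub>2 h) \<bullet> (B (u\<^sub>1 h) *v (u\<^sub>1 h - u\<^sub>2 h)))) has_vector_derivative
      (d * (v \<bullet> (B (u\<^sub>1 t) *v v)) + \<phi> t * ((p\<^sub>1 - p\<^sub>2) \<bullet> (B (u\<^sub>1 t) *v v)
        + v \<bullet> (B' p\<^sub>1 *v v + B (u\<^sub>1 t) *v (p\<^sub>1 - p\<^sub>2))))) (at t within S)"
proof -
  have B: "((\<lambda>h. B (u\<^sub>1 h)) has_vector_derivative B' p\<^sub>1) (at t within S)"
    using vector_derivative_diff_chain_within[OF assms(2) has_derivative_at_withinI[OF assms(4)]]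
    by (simp add: o_def)
  note v = has_vector_derivative_diff[OF assms(2,3)]
  note w = bounded_bilinear.has_vector_derivative[OF bounded_bilinear_matrix_vector_mult B v]
  note i = bounded_bilinear.has_vector_derivative[OF bounded_bilinear_inner v w]
  show ?thesis
    using bounded_bilinear.has_vector_derivative[OF bounded_bilinear_mult assms(1) i]
    by (simp add: v_def algebra_simps)
qed

lemma energy_has_derivative:
  fixes v :: "real \<Rightarrow> 'b::real_inner"
  assumes "(\<phi> has_vector_derivative d) (at t within S)" "(v has_vector_derivative p) (at t within S)"
  shows "((\<lambda>h. \<phi> h * (v h \<bullet> v h)) has_vector_derivative
      (d * (v t \<bullet> v t) + \<phi> t * (2 * (v t \<bullet> p)))) (at t within S)"
  using bounded_bilinear.has_vector_derivative[OF bounded_bilinear_mult assms(1)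
      bounded_bilinear.has_vector_derivative[OF bounded_bilinear_inner assms(2,2)]]
  by (simp add: algebra_simps inner_commute)

section \<open>The cutoff\<close>

text \<open>The norm of the pair \<open>(1, x)\<close> is \<open>sqrt (1 + |x|\<^sup>2)\<close>, a smooth substitute for \<open>|x|\<close> with gradient of
length at most one. The square of the positive part is continuously differentiable.\<close>
definition cutoff :: "real \<Rightarrow> real \<Rightarrow> real \<Rightarrow> 'a::euclidean_space \<Rightarrow> real" where
  "cutoff \<epsilon> c t x = max 0 (1 - \<epsilon> * (norm (1::real, x) + c * t))"

lemma cutoff_bounds:
  assumes "0 \<le> \<epsilon>" "0 \<le> c" "0 \<le> t"
  shows "0 \<le> cutoff \<epsilon> c t x" "cutoff \<epsilon> c t x \<le> 1"
  using assms by (auto simp: cutoff_def)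

lemma cutoff_eq_0:
  assumes "0 < \<epsilon>" "0 \<le> c" "0 \<le> t" "1 / \<epsilon> \<le> norm x"
  shows "cutoff \<epsilon> c t x = 0"
proof -
  have "1 / \<epsilon> \<le> norm (1::real, x) + c * t"
    using assms norm_snd_le[of x "1::real"] by (simp add: add_increasing2)
  then have "1 \<le> \<epsilon> * (norm (1::real, x) + c * t)" using assms by (simp add: field_simps)
  then show ?thesis by (simp add: cutoff_def)
qed

lemma bounded_lipschitz_on_cutoff:
  assumes "0 \<le> \<epsilon>" "0 \<le> c"
  shows "bounded_lipschitz_on ({0..T} \<times> UNIV) (\<lambda>(t, x). cutoff \<epsilon> c t x)"
proof (rule bounded_lipschitz_onI[where M = 1 and L = "\<epsilon> * (1 + c)"])
  fix z z' :: "real \<times> 'a"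
  obtain t x s y where z: "z = (t, x)" "z' = (s, y)" by fastforce
  have "\<bar>norm (1::real, x) - norm (1::real, y)\<bar> \<le> norm (x - y)"
    using norm_triangle_ineq3[of "(1::real, x)" "(1, y)"] by (simp add: norm_Pair)
  also have "\<dots> \<le> dist z z'" unfolding z dist_norm using norm_snd_le[of "x - y" "t - s"] by simp
  finally have 1: "\<bar>norm (1::real, x) - norm (1::real, y)\<bar> \<le> dist z z'" .
  have 2: "\<bar>t - s\<bar> \<le> dist z z'" unfolding z dist_norm using norm_fst_le[of "t - s" "x - y"] by simp
  have "\<bar>cutoff \<epsilon> c t x - cutoff \<epsilon> c s y\<bar>
      \<le> \<bar>\<epsilon> * ((norm (1::real, x) - norm (1::real, y)) + c * (t - s))\<bar>"
    unfolding cutoff_def by (auto simp: algebra_simps max_def)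
  also have "\<dots> \<le> \<epsilon> * (dist z z' + c * dist z z')"
    unfolding abs_mult[of \<epsilon>] using assms 1 2
    by (intro mult_mono order_trans[OF abs_triangle_ineq] add_mono) (auto simp: abs_mult mult_left_mono)
  finally show "norm ((case z of (t, x) \<Rightarrow> cutoff \<epsilon> c t x) - (case z' of (t, x) \<Rightarrow> cutoff \<epsilon> c t x))
      \<le> \<epsilon> * (1 + c) * dist z z'" by (simp add: z algebra_simps)
next
  fix z :: "real \<times> 'a"
  assume "z \<in> {0..T} \<times> UNIV"
  then show "norm (case z of (t, x) \<Rightarrow> cutoff \<epsilon> c t x) \<le> 1"
    using cutoff_bounds[of \<epsilon> c "fst z" "snd z"] assms by auto
qed

lemma square_positive_part_has_derivative:
  "((\<lambda>y::real. (max 0 y)\<^sup>2) has_real_derivative 2 * max 0 s) (at s)"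
proof -
  consider "s > 0" | "s < 0" | "s = 0" by linarith
  then show ?thesis
  proof cases
    case 1
    have "((\<lambda>y::real. y\<^sup>2) has_real_derivative 2 * s) (at s)" by (auto intro!: derivative_eq_intros)
    then have "((\<lambda>y::real. (max 0 y)\<^sup>2) has_real_derivative 2 * s) (at s)"
      by (rule has_field_derivative_transform_within_open[where S = "{0<..}"]) (use 1 in auto)
    then show ?thesis using 1 by simp
  next
    case 2
    have "((\<lambda>y::real. 0) has_real_derivative 0) (at s)" by simp
    then have "((\<lambda>y::real. (max 0 y)\<^sup>2) has_real_derivative 0) (at s)"
      by (rule has_field_derivative_transform_within_open[where S = "{..<0}"]) (use 2 in auto)
    then show ?thesis using 2 by simp
  next
    case 3
    have "((\<lambda>h::real. ((max 0 h)\<^sup>2 - 0) / h) \<longlongrightarrow> 0) (at 0)"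
    proof (rule Lim_null_comparison)
      show "\<forall>\<^sub>F h in at 0. norm (((max 0 h)\<^sup>2 - 0) / h) \<le> \<bar>h\<bar>"
        by (rule always_eventually) (auto simp: max_def power2_eq_square)
      show "((\<lambda>h::real. \<bar>h\<bar>) \<longlongrightarrow> 0) (at 0)" by (intro tendsto_rabs_zero tendsto_ident_at)
    qed
    then show ?thesis using 3 by (simp add: DERIV_def)
  qed
qed

lemma cutoff_time_derivative:
  "((\<lambda>s. (cutoff \<epsilon> c s x)\<^sup>2) has_vector_derivative - (2 * \<epsilon> * c * cutoff \<epsilon> c t x)) (at t within S)"
proof -
  have "((\<lambda>s. 1 - \<epsilon> * (norm (1::real, x) + c * s)) has_real_derivative - (\<epsilon> * c)) (at t within S)"
    by (auto intro!: derivative_eq_intros)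
  from DERIV_chain2[OF square_positive_part_has_derivative this] show ?thesis
    by (simp add: has_real_derivative_iff_has_vector_derivative[symmetric] cutoff_def mult_ac)
qed

lemma cutoff_space_derivative:
  assumes e: "norm e = 1" and \<epsilon>: "0 \<le> \<epsilon>"
  shows "\<exists>d. ((\<lambda>h. (cutoff \<epsilon> c t (x + h *\<^sub>R e))\<^sup>2) has_vector_derivative d) (at 0) \<and>
      \<bar>d\<bar> \<le> 2 * \<epsilon> * cutoff \<epsilon> c t x"
proof -
  let ?N = "\<lambda>h. norm (1::real, x + h *\<^sub>R e)"
  let ?k = "(x \<bullet> e) / norm (1::real, x)"
  have N: "?N h = sqrt (1 + x \<bullet> x + 2 * h * (x \<bullet> e) + h\<^sup>2)" for h
    using e by (simp add: norm_Pair power2_norm_eq_inner inner_add norm_eq_1 inner_commute[of e x])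
      (simp add: power2_eq_square algebra_simps)
  have pos: "0 < 1 + x \<bullet> x" by (simp add: add_pos_nonneg)
  have "((\<lambda>h. sqrt (1 + x \<bullet> x + 2 * h * (x \<bullet> e) + h\<^sup>2)) has_real_derivative ?k) (at 0)"
    using pos N[of 0] by (auto intro!: derivative_eq_intros simp: field_simps)
  then have "(?N has_real_derivative ?k) (at 0)" by (simp only: N)
  then have "((\<lambda>h. 1 - \<epsilon> * (?N h + c * t)) has_real_derivative - (\<epsilon> * ?k)) (at 0)"
    by (auto intro!: derivative_eq_intros)
  from DERIV_chain2[OF square_positive_part_has_derivative this]
  have "((\<lambda>h. (cutoff \<epsilon> c t (x + h *\<^sub>R e))\<^sup>2) has_vector_derivative
      2 * cutoff \<epsilon> c t x * - (\<epsilon> * ?k)) (at 0)"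
    by (simp add: has_real_derivative_iff_has_vector_derivative[symmetric] cutoff_def)
  moreover have "\<bar>x \<bullet> e\<bar> \<le> norm (1::real, x)"
    using Cauchy_Schwarz_ineq2[of x e] e norm_snd_le[of x "1::real"] by simp
  then have "\<bar>?k\<bar> \<le> 1" by (simp add: divide_le_eq_1)
  then have "\<bar>2 * cutoff \<epsilon> c t x * - (\<epsilon> * ?k)\<bar> \<le> 2 * cutoff \<epsilon> c t x * (\<epsilon> * 1)"
    unfolding abs_mult abs_minus_cancel using \<epsilon> by (intro mult_mono) (auto simp: cutoff_def)
  ultimately show ?thesis by (auto simp: mult_ac intro!: exI)
qed

lemma cutoff_tendsto_1: "(\<lambda>k. (cutoff (1 / real (Suc k)) c t x)\<^sup>2) \<longlonglongrightarrow> 1"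
proof -
  have "(\<lambda>k. 1 / real (Suc k)) \<longlonglongrightarrow> 0" using add_inverse_Suc_tendsto[of 0] by simp
  then have "(\<lambda>k. (max 0 (1 - 1 / real (Suc k) * (norm (1::real, x) + c * t)))\<^sup>2)
      \<longlonglongrightarrow> (max 0 (1 - 0 * (norm (1::real, x) + c * t)))\<^sup>2"
    by (intro tendsto_intros)
  then show ?thesis by (simp add: cutoff_def)
qed

section \<open>Essential suprema of solutions and of their gradients\<close>

lemma AE_strip_sections:
  fixes P :: "real \<Rightarrow> 'a::euclidean_space \<Rightarrow> bool"
  assumes "AE (t, x) in lebesgue_on ({0..T} \<times> UNIV). P t x"
  shows "AE t in lborel. t \<in> {0..T} \<longrightarrow> (AE x in lborel. P t x)"
proof -
  have "closed ({0..T} \<times> (UNIV :: 'a set))" by (intro closed_Times) auto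
  then have S: "{0..T} \<times> (UNIV :: 'a set) \<in> sets lebesgue" by auto
  have "AE z in lebesgue. z \<in> {0..T} \<times> UNIV \<longrightarrow> (case z of (t, x) \<Rightarrow> P t x)"
    using assms S by (subst (asm) AE_restrict_space_iff) auto
  then have "AE z in lborel \<Otimes>\<^sub>M lborel. z \<in> {0..T} \<times> UNIV \<longrightarrow> (case z of (t, x) \<Rightarrow> P t x)"
    unfolding lborel_prod by (simp only: AE_completion_iff)
  then have "AE t in lborel. AE x in lborel. (t, x) \<in> {0..T} \<times> UNIV \<longrightarrow> P t x"
    by (drule_tac lborel_pair.AE_pair) simp
  then show ?thesis by eventually_elim auto
qed

text \<open>A bound that holds almost everywhere holds everywhere for a continuous function, because the strip
is the closure of its interior.\<close>
lemma norm_le_amplitude: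
  fixes u :: "real \<Rightarrow> real^'n::finite \<Rightarrow> real^'m::finite"
  assumes T: "0 < T" and u: "bounded_lipschitz_on ({0..T} \<times> UNIV) (\<lambda>(t, x). u t x)"
    and t: "t \<in> {0..T}"
  shows "norm (u t x) \<le> amplitude T u"
proof -
  let ?S = "{0..T} \<times> (UNIV :: (real^'n) set)"
  define f where "f z = norm (u (fst z) (snd z))" for z
  have fc: "continuous_on ?S f"
    using bounded_lipschitz_on_imp_continuous_on[OF u]
    unfolding f_def case_prod_beta by (rule continuous_on_norm)
  have cS: "closed ?S" by (intro closed_Times) auto
  then have S: "?S \<in> sets lebesgue" by auto
  have fm: "(\<lambda>z. ennreal (f z)) \<in> borel_measurable (lebesgue_on ?S)"
    using continuous_imp_measurable_on_sets_lebesgue[OF fc S] by simp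
  define E where "E = esssup (lebesgue_on ?S) (\<lambda>z. ennreal (f z))"
  obtain b where b: "\<And>z. z \<in> ?S \<Longrightarrow> f z \<le> b"
    using bounded_lipschitz_onE[OF u] unfolding f_def case_prod_beta by metis
  have "E \<le> ennreal b"
    unfolding E_def using fm b by (intro esssup_I) (auto intro!: AE_I2 ennreal_leI simp: S)
  then have Efin: "E < top" using ennreal_less_top le_less_trans by blast
  have amp: "amplitude T u = enn2real E"
    by (simp add: amplitude_def Linf_norm_def E_def f_def case_prod_beta)
  have "AE z in lebesgue_on ?S. ennreal (f z) \<le> E"
    unfolding E_def by (rule esssup_AE)
  then have "AE z in lebesgue. z \<in> ?S \<longrightarrow> f z \<le> enn2real E"
    using S Efin by (subst (asm) AE_restrict_space_iff)
      (auto elim!: eventually_mono simp: ennreal_le_iff2 enn2real_nonneg f_def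
        dest!: enn2real_mono)
  then have neg: "negligible {z. \<not> (z \<in> ?S \<longrightarrow> f z \<le> enn2real E)}"
    by (simp add: completion.AE_iff_null_sets negligible_iff_null_sets)
  \<comment> \<open>an open null set is empty, so the bound holds in the interior and, by continuity, on the strip\<close>
  define U where "U = interior ?S \<inter> f -` {enn2real E<..}"
  have "open U"
    unfolding U_def by (intro continuous_open_preimage continuous_on_subset[OF fc] interior_subset) auto
  moreover have "negligible U"
    by (rule negligible_subset[OF neg]) (use interior_subset in \<open>auto simp: U_def\<close>)
  ultimately have "U = {}" using open_not_negligible by blast
  then have sub: "interior ?S \<subseteq> ?S \<inter> f -` {..enn2real E}"
    using interior_subset[of ?S] by (auto simp: U_def not_le[symmetric])
  have "closed (?S \<inter> f -` {..enn2real E})"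
    by (rule continuous_closed_preimage[OF fc cS]) auto
  with sub have "closure (interior ?S) \<subseteq> ?S \<inter> f -` {..enn2real E}"
    by (rule closure_minimal)
  moreover have "closure (interior ?S) = ?S"
  proof -
    have "interior ?S \<noteq> {}" using T by (simp add: interior_Times interior_atLeastAtMost_real)
    moreover have "convex ?S" by (intro convex_Times) auto
    ultimately show ?thesis using convex_closure_interior cS by (metis closure_closed)
  qed
  ultimately have "(t, x) \<in> f -` {..enn2real E}" using t by blast
  then show ?thesis by (simp add: amp f_def)
qed

text \<open>The inequality \<open>esssup lborel (g t) \<le> y\<close> says that the section at \<open>t\<close> of the measurable set where \<open>g\<close>
exceeds \<open>y\<close> is null, and the measure of a section depends measurably on \<open>t\<close>.\<close>
lemma esssup_section_measurable:
  fixes g :: "'a \<Rightarrow> 'b::euclidean_space \<Rightarrow> ennreal"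
  assumes g: "(\<lambda>(t, x). g t x) \<in> borel_measurable (M \<Otimes>\<^sub>M lborel)"
  shows "(\<lambda>t. esssup lborel (g t)) \<in> borel_measurable M"
proof (rule borel_measurableI_le)
  fix y :: ennreal
  define A where "A = {z \<in> space (M \<Otimes>\<^sub>M lborel). y < (case z of (t, x) \<Rightarrow> g t x)}"
  have A: "A \<in> sets (M \<Otimes>\<^sub>M (lborel :: 'b measure))"
    unfolding A_def using g by measurable
  have eq: "esssup lborel (g t) \<le> y \<longleftrightarrow> emeasure lborel (Pair t -` A) = 0" if t: "t \<in> space M" for t
  proof -
    have m: "g t \<in> borel_measurable lborel"
      using measurable_Pair2[OF g t] by simp
    have v: "Pair t -` A = {x \<in> space lborel. \<not> g t x \<le> y}"
      using t by (auto simp: A_def space_pair_measure)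
    have "esssup lborel (g t) \<le> y \<longleftrightarrow> (AE x in lborel. g t x \<le> y)"
      using esssup_AE[of "g t" lborel] esssup_I[OF m, of y] by (auto elim!: eventually_mono order_trans)
    also have "\<dots> \<longleftrightarrow> emeasure lborel (Pair t -` A) = 0"
      unfolding v using m by (intro AE_iff_measurable) auto
    finally show ?thesis .
  qed
  have "(\<lambda>t. emeasure lborel (Pair t -` A)) \<in> borel_measurable M"
    by (rule lborel.measurable_emeasure_Pair[OF A])
  then have "{t \<in> space M. emeasure lborel (Pair t -` A) = 0} \<in> sets M" by measurable
  also have "{t \<in> space M. emeasure lborel (Pair t -` A) = 0} = {t \<in> space M. esssup lborel (g t) \<le> y}"
    using eq by auto
  finally show "{t \<in> space M. esssup lborel (g t) \<le> y} \<in> sets M" .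
qed

lemma partial_has_vector_derivative:
  assumes "has_partial j f x"
  shows "((\<lambda>h. f (x + h *\<^sub>R axis j 1)) has_vector_derivative partial j f x) (at 0)"
  using assms unfolding has_partial_def partial_def by (simp add: vector_derivative_works)

text \<open>A stand-in for \<open>partial\<close> that is jointly Borel measurable in time and space, being built from
countably many difference quotients; the two agree wherever the partial derivative exists.\<close>
definition quotient_partial :: "'n::finite \<Rightarrow> (real^'n \<Rightarrow> real^'m::finite) \<Rightarrow> real^'n \<Rightarrow> real^'m" where
  "quotient_partial j f x =
     lim (\<lambda>k. real (Suc k) *\<^sub>R (f (x + (1 / real (Suc k)) *\<^sub>R axis j 1) - f x))"

definition quotient_grad :: "(real^'n::finite \<Rightarrow> real^'m::finite) \<Rightarrow> real^'n \<Rightarrow> real^'n^'m" where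
  "quotient_grad f x = (\<chi> i j. quotient_partial j f x $ i)"

lemma partial_tendsto:
  assumes "has_partial j f x"
  shows "(\<lambda>k. real (Suc k) *\<^sub>R (f (x + (1 / real (Suc k)) *\<^sub>R axis j 1) - f x)) \<longlonglongrightarrow> partial j f x"
  using difference_quotients_tendsto[OF partial_has_vector_derivative[OF assms]] by simp

lemma grad_eq_quotient_grad:
  assumes "\<forall>j. has_partial j f x"
  shows "grad f x = quotient_grad f x"
proof -
  have "quotient_partial j f x = partial j f x" for j
    unfolding quotient_partial_def by (rule limI[OF partial_tendsto]) (use assms in blast)
  then show ?thesis by (simp add: grad_def quotient_grad_def)
qed

lemma norm_partial_le_grad: "norm (partial j f x :: real^'m::finite) \<le> CARD('m) * norm (grad f x)"
proof -
  have "\<bar>partial j f x $ i\<bar> \<le> norm (grad f x)" for i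
  proof -
    have "\<bar>grad f x $ i $ j\<bar> \<le> norm (grad f x)"
      using component_le_norm_cart[of "grad f x $ i" j] Finite_Cartesian_Product.norm_nth_le[of "grad f x" i] by linarith
    then show ?thesis by (simp add: grad_def)
  qed
  then have "(\<Sum>i\<in>UNIV. \<bar>partial j f x $ i\<bar>) \<le> (\<Sum>i\<in>(UNIV::'m set). norm (grad f x))"
    by (intro sum_mono)
  then show ?thesis using norm_le_l1_cart[of "partial j f x"] by simp
qed

lemma norm_grad_le_lipschitz:
  fixes f :: "real^'n::finite \<Rightarrow> real^'m::finite" and L :: real
  assumes L: "L-lipschitz_on UNIV f" and p: "\<forall>j. has_partial j f x"
  shows "norm (grad f x) \<le> CARD('m) * CARD('n) * L"
proof -
  have "norm (partial j f x) \<le> L" for j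
  proof (rule LIMSEQ_le_const2)
    show "(\<lambda>k. norm (real (Suc k) *\<^sub>R (f (x + (1 / real (Suc k)) *\<^sub>R axis j 1) - f x))) \<longlonglongrightarrow> norm (partial j f x)"
      using p by (intro tendsto_norm partial_tendsto) auto
    have "norm (real (Suc k) *\<^sub>R (f (x + (1 / real (Suc k)) *\<^sub>R axis j 1) - f x)) \<le> L" for k
      using mult_left_mono[OF lipschitz_on_normD[OF L, of "x + (1 / real (Suc k)) *\<^sub>R axis j 1" x], of "real (Suc k)"]
      by simp
    then show "\<exists>N. \<forall>k\<ge>N. norm (real (Suc k) *\<^sub>R (f (x + (1 / real (Suc k)) *\<^sub>R axis j 1) - f x)) \<le> L"
      by blast
  qed
  then have "\<bar>grad f x $ i $ j\<bar> \<le> L" for i j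
    using component_le_norm_cart[of "partial j f x" i] by (auto simp: grad_def intro: order_trans)
  then have row: "norm (grad f x $ i) \<le> (\<Sum>j\<in>(UNIV::'n set). L)" for i
    by (intro order_trans[OF norm_le_l1_cart] sum_mono)
  have "norm (grad f x) \<le> (\<Sum>i\<in>UNIV. norm (grad f x $ i))"
    unfolding norm_vec_def[of "grad f x"] by (rule L2_set_le_sum) simp
  also have "\<dots> \<le> (\<Sum>i\<in>(UNIV::'m set). (\<Sum>j\<in>(UNIV::'n set). L))"
    by (rule sum_mono) (rule row)
  finally have "norm (grad f x) \<le> (\<Sum>i\<in>(UNIV::'m set). (\<Sum>j\<in>(UNIV::'n set). L))" .
  then show ?thesis by simp
qed

lemma quotient_grad_measurable:
  assumes "continuous_on UNIV (\<lambda>(t, x). w t x :: real^'m::finite)"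
  shows "(\<lambda>(t::real, x::real^'n::finite). quotient_grad (w t) x) \<in> borel_measurable borel"
proof -
  have q: "(\<lambda>z. real (Suc k) *\<^sub>R (w (fst z) (snd z + (1 / real (Suc k)) *\<^sub>R axis j 1) - w (fst z) (snd z)))
      \<in> borel_measurable borel" for k and j :: 'n
  proof (intro borel_measurable_continuous_onI continuous_intros)
    show "continuous_on UNIV (\<lambda>z. w (fst z) (snd z + (1 / real (Suc k)) *\<^sub>R axis j 1))"
    proof -
      have "continuous_on UNIV (\<lambda>z::real \<times> (real^'n). (fst z, snd z + (1 / real (Suc k)) *\<^sub>R axis j 1))"
        by (intro continuous_intros)
      from continuous_on_compose2[OF assms this] show ?thesis by simp
    qed
    show "continuous_on UNIV (\<lambda>z. w (fst z) (snd z))"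
      using assms by (simp add: case_prod_beta)
  qed
  have p: "(\<lambda>z. quotient_partial j (w (fst z)) (snd z)) \<in> borel_measurable borel" for j :: 'n
    unfolding quotient_partial_def by (rule borel_measurable_lim_metric[OF q])
  have "(\<lambda>z. quotient_grad (w (fst z)) (snd z)) \<in> borel_measurable borel"
  proof (rule borel_measurable_euclidean_space[THEN iffD2], rule ballI)
    fix b :: "real^'n^'m" assume "b \<in> Basis"
    then obtain i j where b: "b = axis i (axis j 1)"
      by (auto simp: Basis_vec_def)
    have "(\<lambda>z. quotient_partial j (w (fst z)) (snd z) \<bullet> axis i 1) \<in> borel_measurable borel"
      using p by measurable
    then show "(\<lambda>z. quotient_grad (w (fst z)) (snd z) \<bullet> b) \<in> borel_measurable borel"
      unfolding b inner_axis by (simp add: quotient_grad_def)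
  qed
  then show ?thesis by (simp add: case_prod_beta)
qed

lemma Linf_norm_grad:
  fixes f :: "real^'n::finite \<Rightarrow> real^'m::finite" and L :: real
  assumes L: "L-lipschitz_on UNIV f" and p: "AE x in lborel. \<forall>j. has_partial j f x"
    and m: "quotient_grad f \<in> borel_measurable lborel"
  shows "Linf_norm UNIV (grad f) = enn2real (esssup lborel (\<lambda>x. ennreal (norm (quotient_grad f x))))"
    and "Linf_norm UNIV (grad f) \<le> CARD('m) * CARD('n) * L"
    and "AE x in lborel. norm (grad f x) \<le> Linf_norm UNIV (grad f)"
proof -
  have eq: "AE x in lborel. quotient_grad f x = grad f x"
    using p by eventually_elim (auto simp: grad_eq_quotient_grad)
  have mq: "(\<lambda>x. ennreal (norm (quotient_grad f x))) \<in> borel_measurable lborel"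
    using m by measurable
  have gm: "grad f \<in> borel_measurable lebesgue"
    by (rule borel_measurable_AE[OF measurable_completion[OF m] AE_completion[OF eq]])
  have mg: "(\<lambda>x. ennreal (norm (grad f x))) \<in> borel_measurable lebesgue"
    using gm by measurable
  let ?E = "esssup lebesgue (\<lambda>x. ennreal (norm (grad f x)))"
  have "?E = esssup lebesgue (\<lambda>x. ennreal (norm (quotient_grad f x)))"
    by (rule esssup_AE_cong[OF mg measurable_completion[OF mq]])
      (use AE_completion[OF eq] in \<open>eventually_elim, simp\<close>)
  also have "\<dots> = esssup lborel (\<lambda>x. ennreal (norm (quotient_grad f x)))"
    using mq measurable_completion[OF mq] by (simp add: esssup_eq_AE AE_completion_iff)
  finally show "Linf_norm UNIV (grad f) = enn2real (esssup lborel (\<lambda>x. ennreal (norm (quotient_grad f x))))"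
    by (simp add: Linf_norm_def lebesgue_on_UNIV_eq)
  have "?E \<le> ennreal (CARD('m) * CARD('n) * L)"
    by (rule esssup_I[OF mg]) (use AE_completion[OF p] in
      \<open>eventually_elim, intro ennreal_leI norm_grad_le_lipschitz[OF L]\<close>)
  then show "Linf_norm UNIV (grad f) \<le> CARD('m) * CARD('n) * L"
    using lipschitz_on_nonneg[OF L] enn2real_mono[of ?E "ennreal (CARD('m) * CARD('n) * L)"]
    by (simp add: Linf_norm_def lebesgue_on_UNIV_eq)
  have fin: "?E < top"
    using \<open>?E \<le> ennreal (CARD('m) * CARD('n) * L)\<close> ennreal_less_top le_less_trans by blast
  have "AE x in lebesgue. ennreal (norm (grad f x)) \<le> ?E"
    by (rule esssup_AE)
  then have "AE x in lebesgue. norm (grad f x) \<le> Linf_norm UNIV (grad f)"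
    by eventually_elim (use fin enn2real_mono in \<open>fastforce simp: Linf_norm_def lebesgue_on_UNIV_eq\<close>)
  then show "AE x in lborel. norm (grad f x) \<le> Linf_norm UNIV (grad f)"
    by (simp add: AE_completion_iff)
qed

lemma lipschitz_solutionD:
  assumes "lipschitz_solution \<A> T u"
  shows "bounded_lipschitz_on ({0..T} \<times> UNIV) (\<lambda>(t, x). u t x)"
    and "AE t in lborel. t \<in> {0..T} \<longrightarrow> (AE x in lborel.
        (\<lambda>s. u s x) differentiable (at t within {0..T}) \<and> (\<forall>j. has_partial j (u t) x) \<and>
        vector_derivative (\<lambda>s. u s x) (at t within {0..T}) =
          (\<Sum>j\<in>UNIV. \<A> j (u t x) *v partial j (u t) x))"
  using assms unfolding lipschitz_solution_def bounded_lipschitz_on_def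
  by (blast, intro AE_strip_sections) blast

lemma lipschitz_on_section:
  assumes "L-lipschitz_on ({0..T} \<times> UNIV) (\<lambda>(t, x). u t x)" "t \<in> {0..T}"
  shows "L-lipschitz_on UNIV (u t)"
proof (rule lipschitz_onI)
  fix x y show "dist (u t x) (u t y) \<le> L * dist x y"
    using lipschitz_onD[OF assms(1), of "(t, x)" "(t, y)"] assms(2) by (simp add: dist_Pair_Pair)
qed (rule lipschitz_on_nonneg[OF assms(1)])

lemma grad_bound_properties:
  fixes u :: "real \<Rightarrow> real^'n::finite \<Rightarrow> real^'m::finite"
  assumes T: "0 < T" and u: "lipschitz_solution \<A> T u"
  shows "AE t in lborel. t \<in> {0..T} \<longrightarrow> (AE x in lborel. norm (grad (u t) x) \<le> grad_bound u t)"
    and "set_integrable lebesgue {0..T} (grad_bound u)"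
proof -
  obtain L where L: "L-lipschitz_on ({0..T} \<times> UNIV) (\<lambda>(t, x). u t x)"
    using u unfolding lipschitz_solution_def by blast
  \<comment> \<open>freeze \<open>u\<close> outside \<open>[0, T]\<close>, which makes it continuous on the whole space-time\<close>
  define w where "w t = u (max 0 (min T t))" for t
  have wu: "w t = u t" if "t \<in> {0..T}" for t using that by (auto simp: w_def)
  have "continuous_on UNIV (\<lambda>z. (\<lambda>(t, x). u t x) (max 0 (min T (fst z)), snd z))"
    by (rule continuous_on_compose2[OF lipschitz_on_continuous_on[OF L]])
      (use T in \<open>auto intro!: continuous_intros\<close>)
  then have wc: "continuous_on UNIV (\<lambda>(t, x). w t x)"
    by (simp add: w_def case_prod_beta)
  note qm = quotient_grad_measurable[OF wc]
  have qm': "(\<lambda>(t, x). quotient_grad (w t) x) \<in> borel_measurable (lborel \<Otimes>\<^sub>M lborel)"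
    using qm by (simp add: lborel_prod)
  have qs: "quotient_grad (w t) \<in> borel_measurable lborel" for t
    using measurable_Pair2[OF qm', of t] by simp
  define \<beta> where "\<beta> t = enn2real (esssup lborel (\<lambda>x. ennreal (norm (quotient_grad (w t) x))))" for t
  have \<beta>m: "\<beta> \<in> borel_measurable lborel"
  proof -
    have "(\<lambda>(t, x). ennreal (norm (quotient_grad (w t) x))) \<in> borel_measurable (lborel \<Otimes>\<^sub>M lborel)"
      using qm' unfolding case_prod_beta by measurable
    from esssup_section_measurable[OF this] show ?thesis
      unfolding \<beta>_def by measurable
  qed
  have good: "AE t in lborel. t \<in> {0..T} \<longrightarrow> (AE x in lborel. \<forall>j. has_partial j (u t) x)"
    using lipschitz_solutionD(2)[OF u]
    by eventually_elim (auto elim!: eventually_mono)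
  then show "AE t in lborel. t \<in> {0..T} \<longrightarrow> (AE x in lborel. norm (grad (u t) x) \<le> grad_bound u t)"
    by eventually_elim (use Linf_norm_grad(3)[OF lipschitz_on_section[OF L]] qs wu in
        \<open>metis grad_bound_def\<close>)
  from good have \<beta>: "AE t in lborel. t \<in> {0..T} \<longrightarrow> grad_bound u t = \<beta> t \<and> \<bar>\<beta> t\<bar> \<le> CARD('m) * CARD('n) * L"
  proof eventually_elim
    case (elim t)
    show ?case
    proof
      assume t: "t \<in> {0..T}"
      with elim have p: "AE x in lborel. \<forall>j. has_partial j (u t) x" by blast
      have q: "quotient_grad (u t) \<in> borel_measurable lborel" using qs[of t] wu[OF t] by simp
      have "0 \<le> \<beta> t" by (simp add: \<beta>_def)
      then show "grad_bound u t = \<beta> t \<and> \<bar>\<beta> t\<bar> \<le> CARD('m) * CARD('n) * L"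
        using Linf_norm_grad[OF lipschitz_on_section[OF L t] p q] wu[OF t]
        by (simp add: grad_bound_def \<beta>_def)
    qed
  qed
  have i1: "integrable lebesgue (\<lambda>t. indicator {0..T} t *\<^sub>R (CARD('m) * CARD('n) * L))"
    using absolutely_integrable_continuous_real[of 0 T "\<lambda>_. CARD('m) * CARD('n) * L"]
    by (simp add: set_integrable_def)
  have m1: "(\<lambda>t. indicator {0..T} t *\<^sub>R \<beta> t) \<in> borel_measurable lebesgue"
    by (rule measurable_completion) (use \<beta>m in measurable)
  have "integrable lebesgue (\<lambda>t. indicator {0..T} t *\<^sub>R grad_bound u t)"
  proof (rule Bochner_Integration.integrable_bound[OF i1])
    show "(\<lambda>t. indicator {0..T} t *\<^sub>R grad_bound u t) \<in> borel_measurable lebesgue"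
      by (rule borel_measurable_AE[OF m1])
        (use AE_completion[OF \<beta>] in \<open>eventually_elim, auto simp: indicator_def\<close>)
    show "AE t in lebesgue. norm (indicator {0..T} t *\<^sub>R grad_bound u t)
        \<le> norm (indicator {0..T} t *\<^sub>R (CARD('m) * CARD('n) * L))"
      using AE_completion[OF \<beta>] by eventually_elim (auto simp: indicator_def)
  qed
  then show "set_integrable lebesgue {0..T} (grad_bound u)" by (simp add: set_integrable_def)
qed

section \<open>The weighted energy of a difference of solutions\<close>

definition weighted_energy :: "real \<Rightarrow> real \<Rightarrow> (real \<Rightarrow> 'a::euclidean_space \<Rightarrow> 'b::real_inner) \<Rightarrow> real \<Rightarrow> real" where
  "weighted_energy \<epsilon> c v t = (LINT x|lborel. (cutoff \<epsilon> c t x)\<^sup>2 * (v t x \<bullet> v t x))"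

lemma energy_integrand_bounded_lipschitz:
  assumes v: "bounded_lipschitz_on ({0..T} \<times> UNIV) (\<lambda>(t, x). v t x)" and "0 \<le> \<epsilon>" "0 \<le> c"
  shows "bounded_lipschitz_on ({0..T} \<times> UNIV) (\<lambda>(t, x). (cutoff \<epsilon> c t x)\<^sup>2 * (v t x \<bullet> v t x))"
proof -
  note \<chi> = bounded_lipschitz_on_cutoff[OF assms(2,3), of T]
  note \<chi>2 = bounded_lipschitz_on_bilinear[OF bounded_bilinear_mult \<chi> \<chi>]
  note vv = bounded_lipschitz_on_bilinear[OF bounded_bilinear_inner v v]
  show ?thesis
    using bounded_lipschitz_on_bilinear[OF bounded_bilinear_mult \<chi>2 vv]
    by (simp add: case_prod_beta' power2_eq_square)
qed

lemma flux_bounded_lipschitz: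
  fixes B :: "real^'m::finite \<Rightarrow> real^'m^'m"
  assumes v: "bounded_lipschitz_on ({0..T} \<times> UNIV) (\<lambda>(t, x). v t x)"
    and u: "bounded_lipschitz_on ({0..T} \<times> UNIV) (\<lambda>(t, x). u t x)"
    and a: "\<And>t x. t \<in> {0..T} \<Longrightarrow> norm (u t x) \<le> a"
    and B: "bounded_lipschitz_on (cball 0 a) B" and "0 \<le> \<epsilon>" "0 \<le> c"
  shows "bounded_lipschitz_on ({0..T} \<times> UNIV) (\<lambda>(t, x). (cutoff \<epsilon> c t x)\<^sup>2 * (v t x \<bullet> (B (u t x) *v v t x)))"
proof -
  note \<chi> = bounded_lipschitz_on_cutoff[OF assms(5,6), of T]
  note \<chi>2 = bounded_lipschitz_on_bilinear[OF bounded_bilinear_mult \<chi> \<chi>]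
  have "bounded_lipschitz_on ({0..T} \<times> UNIV) (\<lambda>z. B ((\<lambda>(t, x). u t x) z))"
    by (rule bounded_lipschitz_on_compose[OF u B]) (use a in auto)
  note Bv = bounded_lipschitz_on_bilinear[OF bounded_bilinear_matrix_vector_mult this v]
  note vBv = bounded_lipschitz_on_bilinear[OF bounded_bilinear_inner v Bv]
  show ?thesis
    using bounded_lipschitz_on_bilinear[OF bounded_bilinear_mult \<chi>2 vBv]
    by (simp add: case_prod_beta' power2_eq_square)
qed

text \<open>The differential inequality for the weighted energy at a single good time \<open>\<tau>\<close>. The pointwise estimate
\<open>energy_density_derivative_le\<close> holds almost everywhere in space, and the divergence of the flux
disappears upon integration. The factor \<open>CARD('m)\<close> comes from comparing a partial derivative with
the norm of the gradient.\<close>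
lemma weighted_energy_difference_quotients:
  fixes \<A> :: "'n::finite \<Rightarrow> real^'m::finite \<Rightarrow> real^'m^'m"
    and a M \<tau> T \<epsilon> b\<^sub>1 b\<^sub>2 :: real and F :: "real \<Rightarrow> real"
  assumes smooth: "\<And>j. smooth (\<A> j)" and symmetric: "\<And>j v. transpose (\<A> j v) = \<A> j v"
    and bound: "coefficient_bound \<A> a M"
    and u\<^sub>1: "bounded_lipschitz_on ({0..T} \<times> UNIV) (\<lambda>(t, x). u\<^sub>1 t x)" "\<And>t x. t \<in> {0..T} \<Longrightarrow> norm (u\<^sub>1 t x) \<le> a"
    and u\<^sub>2: "bounded_lipschitz_on ({0..T} \<times> UNIV) (\<lambda>(t, x). u\<^sub>2 t x)" "\<And>t x. t \<in> {0..T} \<Longrightarrow> norm (u\<^sub>2 t x) \<le> a"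
    and \<tau>: "\<tau> \<in> {0<..<T}"
    and eq\<^sub>1: "AE x in lborel. (\<lambda>s. u\<^sub>1 s x) differentiable (at \<tau> within {0..T}) \<and> (\<forall>j. has_partial j (u\<^sub>1 \<tau>) x) \<and>
        vector_derivative (\<lambda>s. u\<^sub>1 s x) (at \<tau> within {0..T}) = (\<Sum>j\<in>UNIV. \<A> j (u\<^sub>1 \<tau> x) *v partial j (u\<^sub>1 \<tau>) x)"
    and eq\<^sub>2: "AE x in lborel. (\<lambda>s. u\<^sub>2 s x) differentiable (at \<tau> within {0..T}) \<and> (\<forall>j. has_partial j (u\<^sub>2 \<tau>) x) \<and>
        vector_derivative (\<lambda>s. u\<^sub>2 s x) (at \<tau> within {0..T}) = (\<Sum>j\<in>UNIV. \<A> j (u\<^sub>2 \<tau> x) *v partial j (u\<^sub>2 \<tau>) x)"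
    and g\<^sub>1: "AE x in lborel. norm (grad (u\<^sub>1 \<tau>) x) \<le> b\<^sub>1"
    and g\<^sub>2: "AE x in lborel. norm (grad (u\<^sub>2 \<tau>) x) \<le> b\<^sub>2"
    and \<epsilon>: "0 < \<epsilon>"
  defines "F \<equiv> weighted_energy \<epsilon> (CARD('n) * M) (\<lambda>t x. u\<^sub>1 t x - u\<^sub>2 t x)"
  shows "\<exists>d. (\<lambda>k. real (Suc k) * (F (\<tau> + 1 / real (Suc k)) - F \<tau>)) \<longlonglongrightarrow> d \<and>
      d \<le> (2 * CARD('n) * CARD('m) * M * (b\<^sub>1 + b\<^sub>2)) * F \<tau>"
proof -
  have M: "M > 0" using bound by (simp add: coefficient_bound_def)
  define c where "c = CARD('n) * M"
  have c: "0 \<le> c" using M by (simp add: c_def)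
  define v where "v t x = u\<^sub>1 t x - u\<^sub>2 t x" for t x
  define g where "g t x = (cutoff \<epsilon> c t x)\<^sup>2 * (v t x \<bullet> v t x)" for t x
  define q where "q j x = (cutoff \<epsilon> c \<tau> x)\<^sup>2 * (v \<tau> x \<bullet> (\<A> j (u\<^sub>1 \<tau> x) *v v \<tau> x))" for j x
  define K where "K = 2 * CARD('n) * CARD('m) * M * (b\<^sub>1 + b\<^sub>2)"
  have \<tau>T: "\<tau> \<in> {0..T}" using \<tau> by auto
  have vb: "bounded_lipschitz_on ({0..T} \<times> UNIV) (\<lambda>(t, x). v t x)"
    using bounded_lipschitz_on_diff[OF u\<^sub>1(1) u\<^sub>2(1)] by (simp add: v_def case_prod_beta')
  have gb: "bounded_lipschitz_on ({0..T} \<times> UNIV) (\<lambda>(t, x). g t x)"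
    unfolding g_def using \<epsilon> c by (intro energy_integrand_bounded_lipschitz vb) auto
  have qb: "bounded_lipschitz_on UNIV (q j)" for j
  proof -
    have "bounded_lipschitz_on (cball 0 a) (\<A> j)" using bound by (simp add: coefficient_bound_def)
    then show ?thesis
      unfolding q_def using \<epsilon> c \<tau>T
      by (intro bounded_lipschitz_on_section[OF flux_bounded_lipschitz[OF vb u\<^sub>1]]) auto
  qed
  have g0: "g t x = 0" if "t \<in> {0..T}" "1 / \<epsilon> \<le> norm x" for t x
    using cutoff_eq_0[OF \<epsilon> c _ that(2), of t] that(1) by (simp add: g_def)
  have q0: "q j x = 0" if "1 / \<epsilon> \<le> norm x" for j x
    using cutoff_eq_0[OF \<epsilon> c _ that, of \<tau>] \<tau>T by (simp add: q_def)
  have gi: "integrable lborel (g t)" if "t \<in> {0..T}" for t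
    using bounded_lipschitz_on_section[OF gb that] g0[OF that] by (rule integrable_ball_supported)
  have qi: "integrable lborel (q j)" for j
    using qb q0 by (rule integrable_ball_supported)
  have F: "F t = (LINT x|lborel. g t x)" for t
    by (simp add: F_def weighted_energy_def g_def v_def c_def)
  obtain C where C: "C > 0" "\<And>z z'. z \<in> {0..T} \<times> UNIV \<Longrightarrow> z' \<in> {0..T} \<times> UNIV \<Longrightarrow>
      norm ((case z of (t, x) \<Rightarrow> g t x) - (case z' of (t, x) \<Rightarrow> g t x)) \<le> C * dist z z'"
    using bounded_lipschitz_onE[OF gb] by metis
  have "\<exists>D>0. \<forall>x y. \<bar>q j x - q j y\<bar> \<le> D * dist x y" for j
    using bounded_lipschitz_onE[OF qb] by (metis UNIV_I real_norm_def)
  then obtain D where D: "\<And>j. D j > 0" "\<And>j x y. \<bar>q j x - q j y\<bar> \<le> D j * dist x y" by metis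
  define N where "N = C + (\<Sum>j\<in>UNIV. D j)"
  have CN: "C \<le> N" unfolding N_def using D(1) by (simp add: less_imp_le sum_nonneg)
  have DN: "D j \<le> N" for j
    using member_le_sum[of j UNIV D] D(1) C(1) by (simp add: N_def less_imp_le add_increasing)
  have N0: "0 \<le> N" using C(1) CN by simp
  \<comment> \<open>a step of length at most one can leave the support of the weight by at most one\<close>
  define w where "w x = N * indicator (cball 0 (1 / \<epsilon> + 1)) x" for x :: "real^'n"
  have w: "integrable lborel w"
    unfolding w_def by (intro integrable_mult_right integrable_real_indicator emeasure_bounded_finite) auto
  \<comment> \<open>the value zero for the finitely many steps that leave \<open>[0, T]\<close> keeps the domination uniform\<close>
  define f where "f k x = (if \<tau> + 1 / real (Suc k) \<le> T
      then real (Suc k) * (g (\<tau> + 1 / real (Suc k)) x - g \<tau> x) else 0)" for k x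
  have fm: "f k \<in> borel_measurable lborel" for k
    using gi[OF \<tau>T] gi[of "\<tau> + 1 / real (Suc k)"] \<tau>T unfolding f_def
    by (cases "\<tau> + 1 / real (Suc k) \<le> T") (auto intro!: borel_measurable_times borel_measurable_diff)
  have fb: "\<bar>f k x\<bar> \<le> w x" for k x
  proof (cases "\<tau> + 1 / real (Suc k) \<le> T")
    case True
    let ?t = "\<tau> + 1 / real (Suc k)"
    have t: "?t \<in> {0..T}" using True \<tau>T by simp
    have "\<bar>g ?t x - g \<tau> x\<bar> \<le> C * (1 / real (Suc k))"
      using C(2)[of "(?t, x)" "(\<tau>, x)"] t \<tau>T by (simp add: dist_Pair_Pair dist_real_def)
    then have "real (Suc k) * \<bar>g ?t x - g \<tau> x\<bar> \<le> real (Suc k) * (C * (1 / real (Suc k)))"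
      by (intro mult_left_mono) auto
    then have "\<bar>f k x\<bar> \<le> C" using True by (simp add: f_def abs_mult)
    moreover have "f k x = 0" if "x \<notin> cball 0 (1 / \<epsilon> + 1)"
      using that g0[OF t, of x] g0[OF \<tau>T, of x] by (simp add: f_def)
    ultimately show ?thesis using CN by (cases "x \<in> cball 0 (1 / \<epsilon> + 1)") (auto simp: w_def)
  qed (use N0 in \<open>simp add: f_def w_def\<close>)
  have qd: "\<bar>real (Suc k) * (q j (x + (1 / real (Suc k)) *\<^sub>R axis j 1) - q j x)\<bar> \<le> w x" for j k x
  proof -
    let ?y = "x + (1 / real (Suc k)) *\<^sub>R axis j 1"
    have dy: "dist ?y x = 1 / real (Suc k)" by (simp add: dist_norm)
    have "real (Suc k) * \<bar>q j ?y - q j x\<bar> \<le> real (Suc k) * (D j * (1 / real (Suc k)))"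
      using D(2)[of j ?y x] unfolding dy by (intro mult_left_mono) auto
    then have 1: "\<bar>real (Suc k) * (q j ?y - q j x)\<bar> \<le> D j" by (simp add: abs_mult)
    have "q j ?y = 0 \<and> q j x = 0" if "x \<notin> cball 0 (1 / \<epsilon> + 1)"
    proof -
      have "norm x \<le> norm ?y + dist ?y x"
        using norm_triangle_ineq4[of ?y "?y - x"] by (simp add: dist_norm)
      moreover have "(1::real) / real (Suc k) \<le> 1" by simp
      ultimately have "1 / \<epsilon> \<le> norm ?y" "1 / \<epsilon> \<le> norm x"
        using that unfolding dy mem_cball_0 by linarith+
      then show ?thesis using q0 by blast
    qed
    with 1 DN[of j] show ?thesis by (cases "x \<in> cball 0 (1 / \<epsilon> + 1)") (auto simp: w_def)
  qed
  have ev: "\<forall>\<^sub>F k in sequentially. \<tau> + 1 / real (Suc k) < T"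
    using \<tau> by (intro order_tendstoD(2)[OF add_inverse_Suc_tendsto]) auto
  then have evS: "\<forall>\<^sub>F k in sequentially. \<tau> + 1 / real (Suc k) \<in> {0..T}"
    by eventually_elim (use \<tau>T in auto)
  have lim: "AE x in lborel. \<exists>d. (\<lambda>k. f k x - (\<Sum>j\<in>UNIV. real (Suc k) *
        (q j (x + (1 / real (Suc k)) *\<^sub>R axis j 1) - q j x))) \<longlonglongrightarrow> d \<and> d \<le> K * g \<tau> x"
    using eq\<^sub>1 eq\<^sub>2 g\<^sub>1 g\<^sub>2
  proof eventually_elim
    case (elim x)
    define p\<^sub>1 where "p\<^sub>1 j = partial j (u\<^sub>1 \<tau>) x" for j
    define p\<^sub>2 where "p\<^sub>2 j = partial j (u\<^sub>2 \<tau>) x" for j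
    define r where "r = cutoff \<epsilon> c \<tau> x"
    have r0: "0 \<le> r" by (simp add: r_def cutoff_def)
    have dt\<^sub>1: "((\<lambda>s. u\<^sub>1 s x) has_vector_derivative (\<Sum>j\<in>UNIV. \<A> j (u\<^sub>1 \<tau> x) *v p\<^sub>1 j)) (at \<tau> within {0..T})"
      using elim(1) by (auto simp: vector_derivative_works p\<^sub>1_def)
    have dt\<^sub>2: "((\<lambda>s. u\<^sub>2 s x) has_vector_derivative (\<Sum>j\<in>UNIV. \<A> j (u\<^sub>2 \<tau> x) *v p\<^sub>2 j)) (at \<tau> within {0..T})"
      using elim(2) by (auto simp: vector_derivative_works p\<^sub>2_def)
    have dx\<^sub>1: "((\<lambda>h. u\<^sub>1 \<tau> (x + h *\<^sub>R axis j 1)) has_vector_derivative p\<^sub>1 j) (at 0)" for j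
      using elim(1) partial_has_vector_derivative unfolding p\<^sub>1_def by blast
    have dx\<^sub>2: "((\<lambda>h. u\<^sub>2 \<tau> (x + h *\<^sub>R axis j 1)) has_vector_derivative p\<^sub>2 j) (at 0)" for j
      using elim(2) partial_has_vector_derivative unfolding p\<^sub>2_def by blast
    have "\<exists>d. ((\<lambda>h. (cutoff \<epsilon> c \<tau> (x + h *\<^sub>R axis j 1))\<^sup>2) has_vector_derivative d) (at 0) \<and>
        \<bar>d\<bar> \<le> 2 * \<epsilon> * r" for j :: 'n
      unfolding r_def using \<epsilon> by (intro cutoff_space_derivative) auto
    then obtain d where d: "\<And>j::'n. ((\<lambda>h. (cutoff \<epsilon> c \<tau> (x + h *\<^sub>R axis j 1))\<^sup>2) has_vector_derivative d j) (at 0)"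
        "\<And>j. \<bar>d j\<bar> \<le> 2 * \<epsilon> * r" by metis
    define G where "G = - (2 * \<epsilon> * c * r) * (v \<tau> x \<bullet> v \<tau> x) + r\<^sup>2 * (2 * (v \<tau> x \<bullet>
        ((\<Sum>j\<in>UNIV. \<A> j (u\<^sub>1 \<tau> x) *v p\<^sub>1 j) - (\<Sum>j\<in>UNIV. \<A> j (u\<^sub>2 \<tau> x) *v p\<^sub>2 j))))"
    define Q where "Q j = d j * (v \<tau> x \<bullet> (\<A> j (u\<^sub>1 \<tau> x) *v v \<tau> x)) + r\<^sup>2 * ((p\<^sub>1 j - p\<^sub>2 j) \<bullet> (\<A> j (u\<^sub>1 \<tau> x) *v v \<tau> x)
        + v \<tau> x \<bullet> (frechet_derivative (\<A> j) (at (u\<^sub>1 \<tau> x)) (p\<^sub>1 j) *v v \<tau> x + \<A> j (u\<^sub>1 \<tau> x) *v (p\<^sub>1 j - p\<^sub>2 j)))" for j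
    have "((\<lambda>s. g s x) has_vector_derivative G) (at \<tau> within {0..T})"
      using energy_has_derivative[OF cutoff_time_derivative has_vector_derivative_diff[OF dt\<^sub>1 dt\<^sub>2]]
      by (simp add: g_def G_def v_def r_def)
    from difference_quotients_tendsto[OF this evS]
    have "(\<lambda>k. real (Suc k) * (g (\<tau> + 1 / real (Suc k)) x - g \<tau> x)) \<longlonglongrightarrow> G" by simp
    moreover have "\<forall>\<^sub>F k in sequentially. real (Suc k) * (g (\<tau> + 1 / real (Suc k)) x - g \<tau> x) = f k x"
      using ev by eventually_elim (simp add: f_def)
    ultimately have fG: "(\<lambda>k. f k x) \<longlonglongrightarrow> G" by (rule Lim_transform_eventually)
    have qQ: "(\<lambda>k. real (Suc k) * (q j (x + (1 / real (Suc k)) *\<^sub>R axis j 1) - q j x)) \<longlonglongrightarrow> Q j" for j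
    proof -
      have A: "(\<A> j has_derivative frechet_derivative (\<A> j) (at (u\<^sub>1 \<tau> x))) (at (u\<^sub>1 \<tau> (x + 0 *\<^sub>R axis j 1)))"
        using smooth_has_derivative[OF smooth, of j "u\<^sub>1 \<tau> x"] by simp
      have "((\<lambda>h. q j (x + h *\<^sub>R axis j 1)) has_vector_derivative Q j) (at 0)"
        using flux_has_derivative[OF d(1) dx\<^sub>1 dx\<^sub>2 A] by (simp add: q_def Q_def v_def r_def)
      from difference_quotients_tendsto[OF this] show ?thesis by simp
    qed
    have "(\<lambda>k. f k x - (\<Sum>j\<in>UNIV. real (Suc k) *
        (q j (x + (1 / real (Suc k)) *\<^sub>R axis j 1) - q j x))) \<longlonglongrightarrow> G - (\<Sum>j\<in>UNIV. Q j)"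
      by (intro tendsto_diff tendsto_sum fG qQ)
    moreover have "G - (\<Sum>j\<in>UNIV. Q j) \<le> K * g \<tau> x"
    proof -
      have p: "norm (p\<^sub>1 j) \<le> CARD('m) * b\<^sub>1" "norm (p\<^sub>2 j) \<le> CARD('m) * b\<^sub>2" for j
        using norm_partial_le_grad[of j "u\<^sub>1 \<tau>" x] norm_partial_le_grad[of j "u\<^sub>2 \<tau>" x] elim(3,4)
        unfolding p\<^sub>1_def p\<^sub>2_def by (meson mult_left_mono of_nat_0_le_iff order_trans)+
      have "G - (\<Sum>j\<in>UNIV. Q j) \<le> 2 * CARD('n) * M * (CARD('m) * b\<^sub>1 + CARD('m) * b\<^sub>2) * (r\<^sup>2 * (v \<tau> x \<bullet> v \<tau> x))"
        unfolding G_def Q_def v_def c_def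
        by (rule energy_density_derivative_le[OF bound symmetric u\<^sub>1(2)[OF \<tau>T] u\<^sub>2(2)[OF \<tau>T] p r0 _ d(2)])
          (use \<epsilon> in simp)
      then show ?thesis by (simp add: K_def g_def r_def algebra_simps)
    qed
    ultimately show ?case by blast
  qed
  have "integrable lborel (\<lambda>x. K * g \<tau> x)" using gi[OF \<tau>T] by simp
  from integrated_difference_quotients_tendsto[OF fm fb w qi qd lim this]
  obtain d where d: "(\<lambda>k. LINT x|lborel. f k x) \<longlonglongrightarrow> d" "d \<le> (LINT x|lborel. K * g \<tau> x)"
    by blast
  have "\<forall>\<^sub>F k in sequentially. (LINT x|lborel. f k x) = real (Suc k) * (F (\<tau> + 1 / real (Suc k)) - F \<tau>)"
    using ev
  proof eventually_elim
    case (elim k)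
    then have "integrable lborel (g (\<tau> + 1 / real (Suc k)))" using \<tau>T by (intro gi) auto
    with elim gi[OF \<tau>T] show ?case by (simp add: f_def F del: of_nat_Suc)
  qed
  with d(1) have "(\<lambda>k. real (Suc k) * (F (\<tau> + 1 / real (Suc k)) - F \<tau>)) \<longlonglongrightarrow> d"
    by (rule Lim_transform_eventually)
  moreover have "(LINT x|lborel. K * g \<tau> x) = K * F \<tau>" by (simp add: F)
  ultimately show ?thesis using d(2) unfolding K_def by auto
qed

section \<open>The estimate in the unweighted norm\<close>

lemma in_L2_iff_integrable_lborel:
  assumes "continuous_on UNIV f"
  shows "in_L2 f \<longleftrightarrow> integrable lborel (\<lambda>x. (norm (f x))\<^sup>2)"
    and "L2_norm f = sqrt (LINT x|lborel. (norm (f x))\<^sup>2)"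
proof -
  have f: "f \<in> borel_measurable lborel" using assms by (simp add: borel_measurable_continuous_onI)
  then have "(\<lambda>x. (norm (f x))\<^sup>2) \<in> borel_measurable lborel" by measurable
  with f show "in_L2 f \<longleftrightarrow> integrable lborel (\<lambda>x. (norm (f x))\<^sup>2)"
    and "L2_norm f = sqrt (LINT x|lborel. (norm (f x))\<^sup>2)"
    by (simp_all add: in_L2_def L2_norm_def integrable_completion integral_completion measurable_completion)
qed

text \<open>The weight is at most one, which bounds the weighted energy at time zero by the square of the norm
of \<open>v 0\<close>, and tends to one as \<open>\<epsilon> \<rightarrow> 0\<close>, so that Fatou's lemma applies at time \<open>t\<close>. The constant
\<open>E\<close> has to be the same for all \<open>\<epsilon>\<close>.\<close>
lemma L2_bound_of_weighted_energy_bounds: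
  fixes v :: "real \<Rightarrow> 'a::euclidean_space \<Rightarrow> 'b::euclidean_space"
  assumes v: "bounded_lipschitz_on ({0..T} \<times> UNIV) (\<lambda>(t, x). v t x)" and t: "t \<in> {0..T}"
    and c: "0 \<le> c" and E: "0 \<le> E"
    and energy: "\<And>\<epsilon>. 0 < \<epsilon> \<Longrightarrow> weighted_energy \<epsilon> c v t \<le> E * weighted_energy \<epsilon> c v 0"
    and v0: "in_L2 (v 0)"
  shows "in_L2 (v t) \<and> L2_norm (v t) \<le> sqrt E * L2_norm (v 0)"
proof -
  have t0: "0 \<in> {0..T}" using t by auto
  have cont: "continuous_on UNIV (v s)" if "s \<in> {0..T}" for s
    using bounded_lipschitz_on_imp_continuous_on[OF bounded_lipschitz_on_section[OF v that]] .
  note L0 = in_L2_iff_integrable_lborel[OF cont[OF t0]]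
  note Lt = in_L2_iff_integrable_lborel[OF cont[OF t]]
  define I where "I = (LINT x|lborel. (norm (v 0 x))\<^sup>2)"
  have i0: "integrable lborel (\<lambda>x. (norm (v 0 x))\<^sup>2)" using v0 L0 by simp
  have I0: "0 \<le> I" by (simp add: I_def)
  define h where "h k s x = (cutoff (1 / real (Suc k)) c s x)\<^sup>2 * (norm (v s x))\<^sup>2" for k s x
  have hb: "bounded_lipschitz_on ({0..T} \<times> UNIV) (\<lambda>(s, x). h k s x)" for k
    using energy_integrand_bounded_lipschitz[OF v _ c, of "1 / real (Suc k)"]
    by (simp add: h_def power2_norm_eq_inner)
  have hi: "integrable lborel (h k s)" if "s \<in> {0..T}" for k s
  proof (rule integrable_ball_supported[OF bounded_lipschitz_on_section[OF hb that]])
    fix x :: 'a assume "real (Suc k) \<le> norm x"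
    then have "cutoff (1 / real (Suc k)) c s x = 0"
      using c that by (intro cutoff_eq_0) auto
    then show "h k s x = 0" by (simp add: h_def)
  qed
  have hE: "weighted_energy (1 / real (Suc k)) c v s = (LINT x|lborel. h k s x)" for k s
    by (simp add: weighted_energy_def h_def power2_norm_eq_inner)
  have h_le: "(LINT x|lborel. h k t x) \<le> E * I" for k
  proof -
    have "(LINT x|lborel. h k 0 x) \<le> I"
      unfolding I_def
    proof (rule integral_mono[OF hi[OF t0] i0])
      fix x :: 'a
      have "(cutoff (1 / real (Suc k)) c 0 x)\<^sup>2 \<le> 1"
        using cutoff_bounds[of "1 / real (Suc k)" c 0 x] c by (simp add: power_le_one)
      then show "h k 0 x \<le> (norm (v 0 x))\<^sup>2"
        unfolding h_def by (intro mult_left_le_one_le) auto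
    qed
    then have "E * (LINT x|lborel. h k 0 x) \<le> E * I" using E by (rule mult_left_mono)
    then show ?thesis using energy[of "1 / real (Suc k)"] by (simp add: hE del: of_nat_Suc)
  qed
  have hn: "(\<integral>\<^sup>+x. ennreal (h k t x) \<partial>lborel) \<le> ennreal (E * I)" for k
  proof -
    have "(\<integral>\<^sup>+x. ennreal (h k t x) \<partial>lborel) = ennreal (LINT x|lborel. h k t x)"
      by (rule nn_integral_eq_integral[OF hi[OF t]]) (simp add: h_def)
    then show ?thesis using h_le by (simp only: ennreal_leI)
  qed
  have hm: "(\<lambda>x. ennreal (h k t x)) \<in> borel_measurable lborel" for k
    using borel_measurable_integrable[OF hi[OF t]] by measurable
  have "(\<lambda>k. ennreal (h k t x)) \<longlonglongrightarrow> ennreal (1 * (norm (v t x))\<^sup>2)" for x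
    unfolding h_def by (intro tendsto_ennrealI tendsto_mult cutoff_tendsto_1 tendsto_const)
  then have "(\<lambda>x. ennreal ((norm (v t x))\<^sup>2)) = (\<lambda>x. liminf (\<lambda>k. ennreal (h k t x)))"
    by (intro ext lim_imp_Liminf[symmetric]) simp_all
  then have "(\<integral>\<^sup>+x. ennreal ((norm (v t x))\<^sup>2) \<partial>lborel) \<le> liminf (\<lambda>k. \<integral>\<^sup>+x. ennreal (h k t x) \<partial>lborel)"
    using nn_integral_liminf[of "\<lambda>k x. ennreal (h k t x)" lborel] hm by simp
  also have "\<dots> \<le> ennreal (E * I)"
    using hn by (intro order_trans[OF Liminf_le_Limsup] Limsup_bounded) auto
  finally have nn: "(\<integral>\<^sup>+x. ennreal ((norm (v t x))\<^sup>2) \<partial>lborel) \<le> ennreal (E * I)" .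
  have "v t \<in> borel_measurable lborel"
    using cont[OF t] by (simp add: borel_measurable_continuous_onI)
  then have "(\<lambda>x. (norm (v t x))\<^sup>2) \<in> borel_measurable lborel" by measurable
  then have "integrable lborel (\<lambda>x. (norm (v t x))\<^sup>2)"
  proof (rule integrableI_nonneg)
    show "(\<integral>\<^sup>+x. ennreal ((norm (v t x))\<^sup>2) \<partial>lborel) < \<infinity>"
      using nn by (rule le_less_trans) simp
  qed simp
  moreover have "(LINT x|lborel. (norm (v t x))\<^sup>2) \<le> E * I"
    using nn E I0 by (intro integral_real_bounded) auto
  then have "sqrt (LINT x|lborel. (norm (v t x))\<^sup>2) \<le> sqrt E * sqrt I"
    by (simp flip: real_sqrt_mult)
  ultimately show ?thesis using L0 Lt by (simp add: I_def)
qed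

lemma lipschitz_solutions_L2_estimate:
  fixes \<A> :: "'n::finite \<Rightarrow> real^'m::finite \<Rightarrow> real^'m^'m" and M T t :: real
  assumes smooth: "\<And>j. smooth (\<A> j)" and symmetric: "\<And>j v. transpose (\<A> j v) = \<A> j v"
    and bound: "coefficient_bound \<A> (amplitude T u\<^sub>1 + amplitude T u\<^sub>2) M"
    and T: "0 < T"
    and u\<^sub>1: "lipschitz_solution \<A> T u\<^sub>1" and u\<^sub>2: "lipschitz_solution \<A> T u\<^sub>2"
    and init: "in_L2 (\<lambda>x. u\<^sub>1 0 x - u\<^sub>2 0 x)" and t: "t \<in> {0..T}"
  shows "in_L2 (\<lambda>x. u\<^sub>1 t x - u\<^sub>2 t x) \<and>
    L2_norm (\<lambda>x. u\<^sub>1 t x - u\<^sub>2 t x) \<le>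
      exp (CARD('n) * CARD('m) * M * (LINT \<tau>:{0..t}|lebesgue. grad_bound u\<^sub>1 \<tau> + grad_bound u\<^sub>2 \<tau>))
        * L2_norm (\<lambda>x. u\<^sub>1 0 x - u\<^sub>2 0 x)"
proof -
  define B where "B \<tau> = grad_bound u\<^sub>1 \<tau> + grad_bound u\<^sub>2 \<tau>" for \<tau>
  define c where "c = CARD('n) * M"
  define v where "v t x = u\<^sub>1 t x - u\<^sub>2 t x" for t x
  define \<kappa> where "\<kappa> = CARD('n) * CARD('m) * M"
  have M: "M > 0" using bound by (simp add: coefficient_bound_def)
  then have c: "0 \<le> c" and \<kappa>: "0 \<le> \<kappa>" by (simp_all add: c_def \<kappa>_def)
  note b\<^sub>1 = lipschitz_solutionD(1)[OF u\<^sub>1] and b\<^sub>2 = lipschitz_solutionD(1)[OF u\<^sub>2]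
  have vb: "bounded_lipschitz_on ({0..T} \<times> UNIV) (\<lambda>(t, x). v t x)"
    using bounded_lipschitz_on_diff[OF b\<^sub>1 b\<^sub>2] by (simp add: v_def case_prod_beta')
  have a: "norm (u\<^sub>1 t x) \<le> amplitude T u\<^sub>1 + amplitude T u\<^sub>2"
    "norm (u\<^sub>2 t x) \<le> amplitude T u\<^sub>1 + amplitude T u\<^sub>2" if "t \<in> {0..T}" for t x
    using norm_le_amplitude[OF T b\<^sub>1 that] norm_le_amplitude[OF T b\<^sub>2 that] norm_ge_zero
    by (smt (verit))+
  note gb\<^sub>1 = grad_bound_properties[OF T u\<^sub>1] and gb\<^sub>2 = grad_bound_properties[OF T u\<^sub>2]
  have Bi: "set_integrable lebesgue {0..T} B"
    unfolding B_def using gb\<^sub>1(2) gb\<^sub>2(2) by (rule set_integral_add)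
  have B0: "0 \<le> B \<tau>" for \<tau> by (simp add: B_def grad_bound_def Linf_norm_def)
  \<comment> \<open>the energy is quadratic, hence the factor two, which the square root removes\<close>
  define E where "E = exp (2 * \<kappa> * (LINT \<tau>:{0..t}|lebesgue. B \<tau>))"
  have energy: "weighted_energy \<epsilon> c v t \<le> E * weighted_energy \<epsilon> c v 0" if \<epsilon>: "0 < \<epsilon>" for \<epsilon>
  proof -
    obtain L where L: "L-lipschitz_on {0..T} (weighted_energy \<epsilon> c v)"
      unfolding weighted_energy_def[abs_def]
      using integral_of_ball_supported_family_lipschitz[OF
          energy_integrand_bounded_lipschitz[OF vb less_imp_le[OF \<epsilon>] c], of "1 / \<epsilon>"]
        cutoff_eq_0[OF \<epsilon> c] by fastforce
    have "AE \<tau> in lborel. \<tau> \<in> {0<..<T} \<longrightarrow> (\<exists>d.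
        (\<lambda>k. real (Suc k) * (weighted_energy \<epsilon> c v (\<tau> + 1 / real (Suc k)) - weighted_energy \<epsilon> c v \<tau>)) \<longlonglongrightarrow> d
          \<and> d \<le> 2 * \<kappa> * B \<tau> * weighted_energy \<epsilon> c v \<tau>)"
      using lipschitz_solutionD(2)[OF u\<^sub>1] lipschitz_solutionD(2)[OF u\<^sub>2] gb\<^sub>1(1) gb\<^sub>2(1)
    proof eventually_elim
      case (elim \<tau>)
      show ?case
      proof
        assume \<tau>: "\<tau> \<in> {0<..<T}"
        then have "\<tau> \<in> {0..T}" by auto
        note good = elim[rule_format, OF this]
        have K: "2 * \<kappa> * B \<tau> = 2 * CARD('n) * CARD('m) * M * (grad_bound u\<^sub>1 \<tau> + grad_bound u\<^sub>2 \<tau>)"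
          by (simp add: \<kappa>_def B_def)
        show "\<exists>d. (\<lambda>k. real (Suc k) * (weighted_energy \<epsilon> c v (\<tau> + 1 / real (Suc k)) - weighted_energy \<epsilon> c v \<tau>)) \<longlonglongrightarrow> d
          \<and> d \<le> 2 * \<kappa> * B \<tau> * weighted_energy \<epsilon> c v \<tau>"
          unfolding K v_def[abs_def] c_def
          by (rule weighted_energy_difference_quotients[OF smooth symmetric bound b\<^sub>1 a(1) b\<^sub>2 a(2) \<tau> good \<epsilon>])
      qed
    qed
    then have lim: "AE \<tau> in lebesgue. \<tau> \<in> {0<..<T} \<longrightarrow> (\<exists>d.
        (\<lambda>k. real (Suc k) * (weighted_energy \<epsilon> c v (\<tau> + 1 / real (Suc k)) - weighted_energy \<epsilon> c v \<tau>)) \<longlonglongrightarrow> d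
          \<and> d \<le> 2 * \<kappa> * B \<tau> * weighted_energy \<epsilon> c v \<tau>)"
      by (rule AE_completion)
    have "weighted_energy \<epsilon> c v t \<le> weighted_energy \<epsilon> c v 0 * exp (LINT \<tau>:{0..t}|lebesgue. 2 * \<kappa> * B \<tau>)"
      by (rule gronwall_of_difference_quotients[OF T L _ _ _ lim t])
        (use Bi B0 \<kappa> in \<open>auto simp: weighted_energy_def intro!: Bochner_Integration.integral_nonneg\<close>)
    then show ?thesis by (simp add: E_def mult.commute)
  qed
  have "in_L2 (v t) \<and> L2_norm (v t) \<le> sqrt E * L2_norm (v 0)"
    by (rule L2_bound_of_weighted_energy_bounds[OF vb t c _ energy])
      (use init in \<open>simp_all add: E_def v_def[abs_def]\<close>)
  moreover have "sqrt E = exp (\<kappa> * (LINT \<tau>:{0..t}|lebesgue. B \<tau>))"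
    by (rule real_sqrt_unique) (simp_all add: E_def exp_double[symmetric] mult.assoc)
  ultimately show ?thesis by (simp add: v_def[abs_def] B_def \<kappa>_def)
qed

lemma continuous_L2_norm_zero:
  assumes f: "continuous_on UNIV f" and L2: "in_L2 f" and 0: "L2_norm f \<le> 0"
  shows "f x = 0"
proof -
  have "integrable lebesgue (\<lambda>x. (norm (f x))\<^sup>2)" "(LINT x|lebesgue. (norm (f x))\<^sup>2) = 0"
    using L2 0 by (auto simp: in_L2_def L2_norm_def intro: antisym)
  then have "AE x in lebesgue. f x = 0"
    by (subst (asm) integral_nonneg_eq_0_iff_AE) auto
  then have "negligible (f -` (- {0}))"
    by (simp add: completion.AE_iff_null_sets negligible_iff_null_sets vimage_def)
  moreover have "open (f -` (- {0}))" by (rule open_vimage[OF _ f]) auto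
  ultimately have "f -` (- {0}) = {}" using open_not_negligible by blast
  then show ?thesis by auto
qed

theorem theorem2:
  fixes \<A> :: "'n::finite \<Rightarrow> real^'m::finite \<Rightarrow> real^'m^'m"
  assumes smooth: "\<And>j. smooth (\<A> j)"
    and symmetric: "\<And>j v. transpose (\<A> j v) = \<A> j v"
  shows
    "(\<forall>T > 0. \<forall>u\<^sub>1 u\<^sub>2. lipschitz_solution \<A> T u\<^sub>1 \<longrightarrow> lipschitz_solution \<A> T u\<^sub>2 \<longrightarrow>
        (\<forall>x. u\<^sub>1 0 x = u\<^sub>2 0 x) \<longrightarrow> (\<forall>t\<in>{0..T}. \<forall>x. u\<^sub>1 t x = u\<^sub>2 t x)) \<and>
     (\<exists>C :: real \<Rightarrow> real. (\<forall>a\<ge>0. C a > 0) \<and>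
        (\<forall>T > 0. \<forall>u\<^sub>1 u\<^sub>2. lipschitz_solution \<A> T u\<^sub>1 \<longrightarrow> lipschitz_solution \<A> T u\<^sub>2 \<longrightarrow>
           in_L2 (\<lambda>x. u\<^sub>1 0 x - u\<^sub>2 0 x) \<longrightarrow>
           (let A = amplitude T u\<^sub>1 + amplitude T u\<^sub>2;
                B = (\<lambda>\<tau>. grad_bound u\<^sub>1 \<tau> + grad_bound u\<^sub>2 \<tau>)
            in \<forall>t\<in>{0..T}.
                 in_L2 (\<lambda>x. u\<^sub>1 t x - u\<^sub>2 t x) \<and>
                 L2_norm (\<lambda>x. u\<^sub>1 t x - u\<^sub>2 t x)
                   \<le> C A * exp (C A * (LINT \<tau>:{0..t}|lebesgue. B \<tau>))
                       * L2_norm (\<lambda>x. u\<^sub>1 0 x - u\<^sub>2 0 x))))"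
    (is "?uniqueness \<and> ?stability")
proof
  define M where "M a = (SOME m. coefficient_bound \<A> a m)" for a
  have M: "coefficient_bound \<A> a (M a)" for a
    unfolding M_def by (rule someI_ex[OF coefficient_bound_exists[OF smooth]])
  have M0: "M a > 0" for a using M[of a] by (simp add: coefficient_bound_def)
  note estimate = lipschitz_solutions_L2_estimate[OF smooth symmetric M]
  show ?uniqueness
  proof (intro allI impI ballI)
    fix T :: real and u\<^sub>1 u\<^sub>2 :: "real \<Rightarrow> real^'n \<Rightarrow> real^'m" and t x
    assume T: "0 < T" and u: "lipschitz_solution \<A> T u\<^sub>1" "lipschitz_solution \<A> T u\<^sub>2"
      and eq: "\<forall>x. u\<^sub>1 0 x = u\<^sub>2 0 x" and t: "t \<in> {0..T}"
    have "in_L2 (\<lambda>x. u\<^sub>1 0 x - u\<^sub>2 0 x)" "L2_norm (\<lambda>x. u\<^sub>1 0 x - u\<^sub>2 0 x) = 0"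
      using eq by (simp_all add: in_L2_def L2_norm_def)
    with estimate[OF T u _ t] have "in_L2 (\<lambda>x. u\<^sub>1 t x - u\<^sub>2 t x)" "L2_norm (\<lambda>x. u\<^sub>1 t x - u\<^sub>2 t x) \<le> 0"
      by auto
    moreover have "continuous_on UNIV (\<lambda>x. u\<^sub>1 t x - u\<^sub>2 t x)"
      by (intro continuous_on_diff bounded_lipschitz_on_imp_continuous_on
          bounded_lipschitz_on_section[OF lipschitz_solutionD(1)[OF u(1)] t]
          bounded_lipschitz_on_section[OF lipschitz_solutionD(1)[OF u(2)] t])
    ultimately have "u\<^sub>1 t x - u\<^sub>2 t x = 0" by (rule continuous_L2_norm_zero[rotated])
    then show "u\<^sub>1 t x = u\<^sub>2 t x" by simp
  qed
  \<comment> \<open>one constant serves as factor and in the exponent; the summand one makes it at least one\<close>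
  define C where "C a = 1 + CARD('n) * CARD('m) * M a" for a
  have C1: "1 \<le> C a" and MC: "CARD('n) * CARD('m) * M a \<le> C a" for a
    using M0[of a] by (simp_all add: C_def)
  show ?stability
    unfolding Let_def
  proof (intro exI[of _ C] conjI allI impI ballI)
    show "0 < C a" for a using C1[of a] by simp
    fix T :: real and u\<^sub>1 u\<^sub>2 :: "real \<Rightarrow> real^'n \<Rightarrow> real^'m" and t
    assume T: "0 < T" and u: "lipschitz_solution \<A> T u\<^sub>1" "lipschitz_solution \<A> T u\<^sub>2"
      and init: "in_L2 (\<lambda>x. u\<^sub>1 0 x - u\<^sub>2 0 x)" and t: "t \<in> {0..T}"
    note est = estimate[OF T u init t]
    let ?A = "amplitude T u\<^sub>1 + amplitude T u\<^sub>2"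
    let ?I = "LINT \<tau>:{0..t}|lebesgue. grad_bound u\<^sub>1 \<tau> + grad_bound u\<^sub>2 \<tau>"
    show "in_L2 (\<lambda>x. u\<^sub>1 t x - u\<^sub>2 t x)" using est by blast
    have "0 \<le> ?I"
      unfolding set_lebesgue_integral_def
      by (intro Bochner_Integration.integral_nonneg) (simp add: grad_bound_def Linf_norm_def)
    then have "exp (CARD('n) * CARD('m) * M ?A * ?I) \<le> 1 * exp (C ?A * ?I)"
      using MC[of ?A] by (simp add: mult_right_mono)
    also have "\<dots> \<le> C ?A * exp (C ?A * ?I)"
      using C1[of ?A] by (intro mult_right_mono) auto
    finally have "exp (CARD('n) * CARD('m) * M ?A * ?I) * L2_norm (\<lambda>x. u\<^sub>1 0 x - u\<^sub>2 0 x)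
        \<le> C ?A * exp (C ?A * ?I) * L2_norm (\<lambda>x. u\<^sub>1 0 x - u\<^sub>2 0 x)"
      by (rule mult_right_mono) (simp add: L2_norm_def)
    with est show "L2_norm (\<lambda>x. u\<^sub>1 t x - u\<^sub>2 t x)
        \<le> C ?A * exp (C ?A * ?I) * L2_norm (\<lambda>x. u\<^sub>1 0 x - u\<^sub>2 0 x)"
      by linarith
  qed
qed

end
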